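(* Let $s>1$, $r\ge 0$ and $1\le p<\infty$ satisfy $1<(s-r)p/2<(s-1)p+1$. Then the Bergman space $A^p_{(s-r)p/2}(\mathbb{D})$ and the coorbit space $\mathrm{Co}_{\mathcal{H}_s^\infty}^uL^p_r(G)$ coincide, with equivalent norms, where a holomorphic function on $\mathbb{D}$ is identified with its power series at $0$, regarded as an element of $\mathcal{H}_s^{-\infty}$.
   Context: $\mathbb{D}$ is the unit disc in $\mathbb{C}$ with area measure $dz$. For $1\le p<\infty$, $\sigma>1$, $A^p_\sigma(\mathbb{D})$ is the space of holomorphic $f$ on $\mathbb{D}$ with $\|f\|_{A^p_\sigma}^p=\int_{\mathbb{D}}|f(z)|^p(1-|z|^2)^{\sigma-2}\,dz<\infty$. $G=\left\{\begin{pmatrix}a&b\\0&a^{-1}\end{pmatrix}: a>0,\ b\in\mathbb{R}\right\}$, whose elements are written $(a,b)$, with left Haar measure $\frac{da\,db}{a^2}$. To $(a,b)$ one associates the matrix $\begin{pmatrix}\alpha&\beta\\\bar\beta&\bar\alpha\end{pmatrix}\in SU(1,1)$ with $\alpha=\frac12(a+a^{-1}+ib)$, $\beta=\frac12(b+i(a-a^{-1}))$. For real $s>1$, $\mathcal{H}_s=A^2_s(\mathbb{D})$ with inner product $(u,v)_s=\frac{s-1}{\pi}\int_{\mathbb{D}}u(z)\overline{v(z)}(1-|z|^2)^{s-2}\,dz$, and $\pi_s$ is the unitary representation of $G$ on $\mathcal{H}_s$ given by $$\pi_s(a,b)v(z)=(-\bar\beta z+\alpha)^{-s}\,v\Big(\frac{\bar\alpha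 z-\beta}{-\bar\beta z+\alpha}\Big)$$ (principal branch of the power: $\mathrm{Re}\,\alpha>0$ and $(-\bar\beta z+\alpha)^{-s}=\alpha^{-s}(1-\tfrac{\bar\beta}{\alpha}z)^{-s}$). $\mathcal{H}_s^\infty$ (smooth vectors) is the Fréchet space of power series $\sum_k a_kz^k$ such that for every $m$ there is $C$ with $|a_k|^2\le C\frac{(s+k-1)!}{(s-1)!\,k!}(1+k)^{-m}$ for all $k$; its conjugate dual $\mathcal{H}_s^{-\infty}$ is the space of formal power series $\sum_kb_kz^k$ for which there are $m$ and $C$ with $|b_k|^2\le C\frac{(s+k-1)!}{(s-1)!\,k!}(1+k)^{m}$ for all $k$ (here $x!=\Gamma(x+1)$). The pairing extends $(\cdot,\cdot)_s$: $\langle\sum b_kz^k,\sum a_kz^k\rangle=\sum_kb_k\overline{a_k}\frac{(s-1)!\,k!}{(s+k-1)!}$. $u$ is the constant function $1$ on $\mathbb{D}$ and $W_u^s(\phi)(a,b)=\langle\phi,\pi_s(a,b)u\rangle$ for $\phi\in\mathcal{H}_s^{-\infty}$. With $w_r(a,b)=2^r[(a+a^{-1})^2+b^2]^{r/2}$, $L^p_r(G)$ is the space of measurable $f$ with $\|f\|_{L^p_r}=\big(\int|f(a,b)w_r(a,b)|^p\frac{da\,db}{a^2}\big)^{1/p}<\infty$. Finally $\mathrm{Co}_{\mathcal{H}_s^\infty}^uL^p_r(G)=\{\phi\in\mathcal{H}_s^{-\infty}: W_u^s(\phi)\in L^p_r(G)\}$ with norm $\|W_u^s(\phi)\|_{L^p_r}$.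 *)

theory Defs
  imports "HOL-Complex_Analysis.Complex_Analysis"
begin

definition bergman_norm :: "real \<Rightarrow> real \<Rightarrow> (complex \<Rightarrow> complex) \<Rightarrow> real" where
  "bergman_norm p \<sigma> f =
     (LINT z:ball 0 1|lborel. cmod (f z) powr p * (1 - (cmod z)\<^sup>2) powr (\<sigma> - 2)) powr (1 / p)"

text \<open>The elements are total functions on \<open>complex\<close>; only their values on the unit disc
  carry information, and two members that agree there represent the same element of the space.\<close>

definition bergman_space :: "real \<Rightarrow> real \<Rightarrow> (complex \<Rightarrow> complex) set" where
  "bergman_space p \<sigma> =
     {f. f holomorphic_on ball 0 1 \<and>
         set_integrable lborel (ball 0 1)
           (\<lambda>z. cmod (f z) powr p * (1 - (cmod z)\<^sup>2) powr (\<sigma> - 2))}"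

text \<open>The group \<open>G\<close> of the matrices with rows \<open>(a, b)\<close> and \<open>(0, 1/a)\<close>, where \<open>a > 0\<close>, is
  parametrised by the pairs \<open>(a, b)\<close>; \<open>haar_G\<close> is its left Haar measure \<open>da db / a\<^sup>2\<close>.\<close>

definition haar_G :: "(real \<times> real) measure" where
  "haar_G = density (restrict_space lborel ({0<..} \<times> UNIV)) (\<lambda>(a, b). ennreal (1 / a\<^sup>2))"

definition SU_alpha :: "real \<Rightarrow> real \<Rightarrow> complex" where
  "SU_alpha a b = (of_real a + of_real (inverse a) + \<i> * of_real b) / 2"

definition SU_beta :: "real \<Rightarrow> real \<Rightarrow> complex" where
  "SU_beta a b = (of_real b + \<i> * (of_real a - of_real (inverse a))) / 2"

definition pi_rep :: "real \<Rightarrow> real \<times> real \<Rightarrow> (complex \<Rightarrow> complex) \<Rightarrow> complex \<Rightarrow> complex" where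
  "pi_rep s = (\<lambda>(a, b) v z.
     (let \<alpha> = SU_alpha a b; \<beta> = SU_beta a b
      in (- cnj \<beta> * z + \<alpha>) powr (- of_real s) * v ((cnj \<alpha> * z - \<beta>) / (- cnj \<beta> * z + \<alpha>))))"

lemma SU_alpha_beta:
  assumes "a > 0"
  shows "(cmod (SU_alpha a b))\<^sup>2 - (cmod (SU_beta a b))\<^sup>2 = 1"
  using assms unfolding SU_alpha_def SU_beta_def cmod_power2
  by (simp add: field_simps power2_eq_square)

text \<open>The principal power in the definition of \<open>pi_rep\<close> is the holomorphic branch obtained by
  factoring out \<open>\<alpha>\<close>, whose real part is positive.\<close>

lemma pi_rep_branch:
  assumes "a > 0" "cmod z < 1"
  shows "(- cnj (SU_beta a b) * z + SU_alpha a b) powr (- of_real s) =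
    SU_alpha a b powr (- of_real s) * (1 - cnj (SU_beta a b) / SU_alpha a b * z) powr (- of_real s)"
proof -
  define A where "A = SU_alpha a b"
  define B where "B = SU_beta a b"
  define w where "w = 1 - cnj B / A * z"
  have ReA: "Re A > 0"
    using assms by (simp add: A_def SU_alpha_def add_pos_pos)
  hence A0: "A \<noteq> 0" by auto
  have "(cmod B)\<^sup>2 < (cmod A)\<^sup>2"
    using SU_alpha_beta[OF assms(1), of b] by (simp add: A_def B_def)
  hence BA: "cmod B < cmod A"
    by (rule power_less_imp_less_base) simp
  have "cmod (cnj B / A * z) = cmod B / cmod A * cmod z"
    by (simp add: norm_mult norm_divide)
  also have "\<dots> \<le> 1 * cmod z"
    using BA A0 by (intro mult_right_mono) (auto simp: divide_simps)
  finally have "cmod (cnj B / A * z) < 1" using assms by simp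
  hence "Re (cnj B / A * z) < 1" using complex_Re_le_cmod[of "cnj B / A * z"] by linarith
  hence Rew: "Re w > 0" by (simp add: w_def)
  hence w0: "w \<noteq> 0" by auto
  have "\<bar>Im (Ln A)\<bar> < pi / 2" "\<bar>Im (Ln w)\<bar> < pi / 2"
    using ReA Rew A0 w0 Re_Ln_pos_lt by blast+
  hence "Ln (A * w) = Ln A + Ln w"
    using A0 w0 by (intro Ln_times_simple) auto
  moreover have "- cnj B * z + A = A * w"
    using A0 by (simp add: w_def field_simps)
  ultimately show ?thesis
    using A0 w0 unfolding A_def[symmetric] B_def[symmetric] w_def[symmetric]
    by (simp add: powr_def exp_add[symmetric] ring_distribs)
qed

text \<open>\<open>hs_weight s k\<close> is \<open>(s+k-1)! / ((s-1)! k!)\<close> with \<open>x! = \<Gamma>(x+1)\<close>.\<close>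

definition hs_weight :: "real \<Rightarrow> nat \<Rightarrow> real" where
  "hs_weight s k = Gamma (s + real k) / (Gamma s * fact k)"

definition smooth_vectors :: "real \<Rightarrow> complex fps set" where
  "smooth_vectors s =
     {v. \<forall>m::nat. \<exists>C. \<forall>k. (cmod (fps_nth v k))\<^sup>2 \<le> C * hs_weight s k / (1 + real k) ^ m}"

definition dist_vectors :: "real \<Rightarrow> complex fps set" where
  "dist_vectors s =
     {\<phi>. \<exists>(m::nat) C. \<forall>k. (cmod (fps_nth \<phi> k))\<^sup>2 \<le> C * hs_weight s k * (1 + real k) ^ m}"

definition dual_pairing :: "real \<Rightarrow> complex fps \<Rightarrow> complex fps \<Rightarrow> complex" where
  "dual_pairing s \<phi> v =
     (\<Sum>k. fps_nth \<phi> k * cnj (fps_nth v k) / of_real (hs_weight s k))"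

lemma dual_pairing_summable:
  assumes s: "s > 1" and \<phi>: "\<phi> \<in> dist_vectors s" and v: "v \<in> smooth_vectors s"
  shows "summable (\<lambda>k. cmod (fps_nth \<phi> k * cnj (fps_nth v k) / of_real (hs_weight s k)))"
proof -
  have pos: "hs_weight s k > 0" for k
    using s by (simp add: hs_weight_def Gamma_real_pos)
  obtain m :: nat and C where C:
    "\<And>k. (cmod (fps_nth \<phi> k))\<^sup>2 \<le> C * hs_weight s k * (1 + real k) ^ m"
    using \<phi> by (auto simp: dist_vectors_def)
  obtain D where D:
    "\<And>k. (cmod (fps_nth v k))\<^sup>2 \<le> D * hs_weight s k / (1 + real k) ^ (m + 4)"
    using v by (fastforce simp: smooth_vectors_def)
  have "0 \<le> C * hs_weight s 0" using C[of 0] by (simp add: order_trans[OF zero_le_power2])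
  hence C0: "C \<ge> 0" using pos[of 0] by (simp add: zero_le_mult_iff)
  have bound: "cmod (fps_nth \<phi> k * cnj (fps_nth v k) / of_real (hs_weight s k))
      \<le> sqrt (C * D) * (1 / (real (Suc k))\<^sup>2)" for k
  proof -
    define h n where "h = hs_weight s k" and "n = 1 + real k"
    have h: "h > 0" and n: "n > 0" using pos by (auto simp: h_def n_def)
    have "(cmod (fps_nth \<phi> k) * cmod (fps_nth v k))\<^sup>2 \<le> (C * h * n ^ m) * (D * h / n ^ (m + 4))"
      unfolding power_mult_distrib h_def n_def
      using C0 pos[of k] by (intro mult_mono C D) auto
    also have "\<dots> = C * D * (h / n\<^sup>2)\<^sup>2"
      using n by (simp add: field_simps power_add power2_eq_square eval_nat_numeral)
    finally have "cmod (fps_nth \<phi> k) * cmod (fps_nth v k) \<le> sqrt (C * D * (h / n\<^sup>2)\<^sup>2)"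
      by (rule real_le_rsqrt)
    also have "\<dots> = sqrt (C * D) * (h / n\<^sup>2)"
      using h n by (simp add: real_sqrt_mult)
    finally show ?thesis
      using h n by (simp add: norm_mult norm_divide h_def[symmetric] n_def[symmetric] field_simps)
  qed
  have "summable (\<lambda>k. sqrt (C * D) * (1 / (real (Suc k))\<^sup>2))"
    using inverse_power_summable[of 2, where ?'a = real]
    by (intro summable_mult, subst summable_Suc_iff) (simp add: inverse_eq_divide)
  thus ?thesis
    by (rule summable_comparison_test'[where N = 0]) (use bound in auto)
qed

definition voice :: "real \<Rightarrow> (complex \<Rightarrow> complex) \<Rightarrow> complex fps \<Rightarrow> real \<times> real \<Rightarrow> complex" where
  "voice s u \<phi> x = dual_pairing s \<phi> (fps_expansion (pi_rep s x u) 0)"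

definition weight :: "real \<Rightarrow> real \<times> real \<Rightarrow> real" where
  "weight r = (\<lambda>(a, b). 2 powr r * ((a + inverse a)\<^sup>2 + b\<^sup>2) powr (r / 2))"

definition Lpr_norm :: "real \<Rightarrow> real \<Rightarrow> (real \<times> real \<Rightarrow> complex) \<Rightarrow> real" where
  "Lpr_norm p r f = (LINT x|haar_G. cmod (f x * of_real (weight r x)) powr p) powr (1 / p)"

definition Lpr_space :: "real \<Rightarrow> real \<Rightarrow> (real \<times> real \<Rightarrow> complex) set" where
  "Lpr_space p r =
     {f \<in> borel_measurable haar_G.
        integrable haar_G (\<lambda>x. cmod (f x * of_real (weight r x)) powr p)}"

definition coorbit :: "real \<Rightarrow> (complex \<Rightarrow> complex) \<Rightarrow> real \<Rightarrow> real \<Rightarrow> complex fps set" where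
  "coorbit s u p r = {\<phi> \<in> dist_vectors s. voice s u \<phi> \<in> Lpr_space p r}"

definition coorbit_norm :: "real \<Rightarrow> (complex \<Rightarrow> complex) \<Rightarrow> real \<Rightarrow> real \<Rightarrow> complex fps \<Rightarrow> real" where
  "coorbit_norm s u p r \<phi> = Lpr_norm p r (voice s u \<phi>)"

end

theory Submission
  imports Defs
begin

text \<open>
  The binomial series of \<open>(1 - x) powr (- s)\<close> has the coefficients \<open>hs_weight s k\<close>, and the dual pairing
  divides by the same numbers. The two cancel, so the voice transform of a power series \<open>f\<close> against
  the constant function \<open>1\<close> is a point evaluation: with \<open>\<alpha> = SU_alpha a b\<close>, \<open>\<beta> = SU_beta a b\<close> and
  \<open>\<omega> = \<beta> / cnj \<alpha>\<close>, its value at \<open>(a, b)\<close> is \<open>cnj (\<alpha> powr (- s)) * f \<omega>\<close>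
  (\<open>voice_one\<close>). Since \<open>1 - (cmod \<omega>)\<^sup>2 = 1 / (cmod \<alpha>)\<^sup>2\<close> and the weight is
  \<open>4 powr r * cmod \<alpha> powr r\<close>, the \<open>p\<close>-th power of the weighted voice transform equals
  \<open>4 powr (r * p)\<close> times \<open>cmod (f \<omega>) powr p * (1 - (cmod \<omega>)\<^sup>2) powr ((s - r) * p / 2)\<close>.

  The point \<open>\<omega>\<close> is the image of the origin of the disc under the Moebius action of \<open>(a, b)\<close>; in the
  upper half plane this is \<open>\<i>\<close> moved to \<open>a * b + \<i> * a\<^sup>2\<close>. So \<open>(a, b) \<mapsto> \<omega>\<close>
  is a diffeomorphism of the group onto the disc, and it carries the left Haar measure to a multiple of the
  invariant measure \<open>dz / (1 - (cmod z)\<^sup>2)\<^sup>2\<close>; the Jacobian determinant shows that the multiple is 2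
  (\<open>haar_disc\<close>). Hence the coorbit norm is exactly \<open>4 powr r * 2 powr (1 / p)\<close> times the Bergman norm
  (\<open>bergman_Lpr\<close>).

  It remains to see that the two spaces are drawn from the same supply of power series. The weights
  \<open>hs_weight s k\<close> lie between \<open>1\<close> and a power of \<open>1 + k\<close>, so a distribution vector is a series with
  polynomially bounded coefficients. Such a series converges in the disc and defines a holomorphic
  function there (\<open>dist_vectors_conv_radius\<close>). Conversely the coefficients of a Bergman function are
  polynomially bounded (\<open>bergman_coefficient_bound\<close>): they are recovered by integrating the function
  against \<open>cnj z ^ k\<close> over a slightly smaller disc, where the Bergman weight is bounded below by a power
  of the distance to the circle.
\<close>

section \<open>Change of variables in the plane\<close>

text \<open>
  Lebesgue measure is determined by the volume of boxes, and a linear isometry that matches up the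
  standard bases of two spaces takes boxes to boxes with the same side lengths. This identifies the Lebesgue
  measures of \<open>real^2\<close>, \<open>real \<times> real\<close> and \<open>complex\<close>.
\<close>

lemma lborel_distr_coordinate_isometry:
  fixes e :: "'a::euclidean_space \<Rightarrow> 'b::euclidean_space"
  assumes lin: "linear e" and inner: "\<And>x y. e x \<bullet> e y = x \<bullet> y" and Basis: "e ` Basis = Basis"
  shows "distr lborel borel e = lborel"
proof (rule lborel_eqI[symmetric])
  have meas: "e \<in> borel_measurable borel"
    using lin by (intro borel_measurable_continuous_onI linear_continuous_on)
      (simp add: linear_conv_bounded_linear)
  have inj: "inj_on e Basis"
  proof (rule inj_onI)
    fix x y assume "e x = e y"
    hence "e (x - y) \<bullet> e (x - y) = 0" by (simp add: linear_diff[OF lin])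
    thus "x = y" by (simp add: inner)
  qed
  fix l u :: 'b assume le: "\<And>b. b \<in> Basis \<Longrightarrow> l \<bullet> b \<le> u \<bullet> b"
  \<comment> \<open>\<open>pb\<close> is the inverse of \<open>e\<close>, so that \<open>pb l\<close> and \<open>pb u\<close> are the corners of the preimage of the box.\<close>
  define pb where "pb y = (\<Sum>j\<in>Basis. (y \<bullet> e j) *\<^sub>R j)" for y :: 'b
  have pb: "pb y \<bullet> b = y \<bullet> e b" if "b \<in> Basis" for y b
    using that by (simp add: pb_def inner_sum_left inner_Basis if_distrib sum.delta cong: if_cong)
  have "e -` box l u = box (pb l) (pb u)"
    by (auto simp: box_def pb inner simp flip: Basis)
  hence "emeasure (distr lborel borel e) (box l u) = emeasure lborel (box (pb l) (pb u))"
    using meas by (simp add: emeasure_distr)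
  also have "\<dots> = (\<Prod>b\<in>Basis. (pb u - pb l) \<bullet> b)"
    using le Basis by (subst emeasure_lborel_box) (auto simp: pb)
  also have "(\<Prod>b\<in>Basis. (pb u - pb l) \<bullet> b) = (\<Prod>b\<in>Basis. (u - l) \<bullet> e b)"
    by (intro prod.cong refl) (simp add: pb inner_diff_left)
  also have "\<dots> = (\<Prod>b\<in>Basis. (u - l) \<bullet> b)"
    using prod.reindex[OF inj, of "\<lambda>b. (u - l) \<bullet> b"] by (simp add: Basis o_def)
  finally show "emeasure (distr lborel borel e) (box l u) = (\<Prod>b\<in>Basis. (u - l) \<bullet> b)" .
qed simp

lemma set_lborel_transport:
  fixes e :: "'a::euclidean_space \<Rightarrow> 'b::euclidean_space" and F :: "'b \<Rightarrow> real"
  assumes e: "e \<in> borel_measurable borel" "distr lborel borel e = lborel"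
    and S: "open S" and F: "continuous_on S F"
  shows "set_integrable lborel (e -` S) (\<lambda>x. F (e x)) \<longleftrightarrow> set_integrable lborel S F"
    and "(LINT x:e -` S|lborel. F (e x)) = (LINT y:S|lborel. F y)"
proof -
  have m: "(\<lambda>y. indicator S y *\<^sub>R F y) \<in> borel_measurable borel"
    using S F by (intro borel_measurable_continuous_on_indicator) auto
  have eq: "indicat_real (e -` S) x = indicator S (e x)" for x
    by (simp add: indicator_def)
  show "set_integrable lborel (e -` S) (\<lambda>x. F (e x)) \<longleftrightarrow> set_integrable lborel S F"
    using integrable_distr_eq[of e lborel borel, OF _ m] e by (simp add: set_integrable_def eq)
  show "(LINT x:e -` S|lborel. F (e x)) = (LINT y:S|lborel. F y)"
    using integral_distr[of e lborel borel, OF _ m] e by (simp add: set_lebesgue_integral_def eq)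
qed

lemma set_lebesgue_lborel:
  fixes F :: "'a::euclidean_space \<Rightarrow> real"
  assumes S: "open S" and F: "continuous_on S F"
  shows "F absolutely_integrable_on S \<longleftrightarrow> set_integrable lborel S F"
    and "(LINT x:S|lebesgue. F x) = (LINT x:S|lborel. F x)"
proof -
  have m: "(\<lambda>y. indicator S y *\<^sub>R F y) \<in> borel_measurable lborel"
    using borel_measurable_continuous_on_indicator[OF _ F] S by simp
  show "F absolutely_integrable_on S \<longleftrightarrow> set_integrable lborel S F"
    unfolding set_integrable_def by (rule integrable_completion[OF m])
  show "(LINT x:S|lebesgue. F x) = (LINT x:S|lborel. F x)"
    unfolding set_lebesgue_integral_def by (rule integral_completion[OF m])
qed

text \<open>
  The transformation formula for absolutely integrable functions, restated for Lebesgue integrals with respect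
  to \<open>lborel\<close>. Continuity of the integrand and openness of the domains make it Borel measurable, so
  passing from the completed measure to \<open>lborel\<close> changes nothing.
\<close>

lemma continuous_change_of_variables:
  fixes F :: "real^'n::{finite,wellorder} \<Rightarrow> real" and g :: "real^'n::_ \<Rightarrow> real^'n::_"
  assumes S: "open S" and gS: "open (g ` S)"
    and der: "\<And>x. x \<in> S \<Longrightarrow> (g has_derivative g' x) (at x)"
    and inj: "inj_on g S"
    and J: "\<And>x. x \<in> S \<Longrightarrow> \<bar>det (matrix (g' x))\<bar> = J x" "continuous_on S J"
    and F: "continuous_on (g ` S) F"
  shows "set_integrable lborel S (\<lambda>x. J x * F (g x)) \<longleftrightarrow> set_integrable lborel (g ` S) F"
    and "(LINT x:S|lborel. J x * F (g x)) = (LINT y:g ` S|lborel. F y)"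
proof -
  have gc: "continuous_on S g"
    by (intro continuous_at_imp_continuous_on ballI has_derivative_continuous[OF der])
  have c: "continuous_on S (\<lambda>x. J x * F (g x))"
    by (intro continuous_on_mult J continuous_on_compose2[OF F gc] subset_refl)
  have S': "S \<in> sets lebesgue" using S by auto
  have main: "(\<lambda>x. J x * F (g x)) absolutely_integrable_on S \<and> integral S (\<lambda>x. J x * F (g x)) = b
     \<longleftrightarrow> F absolutely_integrable_on (g ` S) \<and> integral (g ` S) F = b" for b
  proof -
    have "(\<lambda>x. J x * F (g x)) absolutely_integrable_on S \<longleftrightarrow>
        (\<lambda>x. \<bar>det (matrix (g' x))\<bar> *\<^sub>R F (g x)) absolutely_integrable_on S"
      "integral S (\<lambda>x. J x * F (g x)) = integral S (\<lambda>x. \<bar>det (matrix (g' x))\<bar> *\<^sub>R F (g x))"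
      using J(1) by (simp_all cong: set_integrable_cong integral_cong)
    moreover have "(\<lambda>x. \<bar>det (matrix (g' x))\<bar> *\<^sub>R F (g x)) absolutely_integrable_on S \<and>
        integral S (\<lambda>x. \<bar>det (matrix (g' x))\<bar> *\<^sub>R F (g x)) = b
      \<longleftrightarrow> F absolutely_integrable_on (g ` S) \<and> integral (g ` S) F = b"
      using has_absolute_integral_change_of_variables[OF S' has_derivative_at_withinI[OF der] inj,
        of "\<lambda>x. vec (F x) :: real^1" "vec b"]
      unfolding absolutely_integrable_on_1_iff integral_on_1_eq
      by (auto simp: vec_eq_iff)
    ultimately show ?thesis by simp
  qed
  show iff: "set_integrable lborel S (\<lambda>x. J x * F (g x)) \<longleftrightarrow> set_integrable lborel (g ` S) F"
    using main set_lebesgue_lborel[OF S c] set_lebesgue_lborel[OF gS F] by blast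
  show "(LINT x:S|lborel. J x * F (g x)) = (LINT y:g ` S|lborel. F y)"
  proof (cases "set_integrable lborel (g ` S) F")
    case True
    hence F_int: "F absolutely_integrable_on (g ` S)" by (simp only: set_lebesgue_lborel(1)[OF gS F])
    with main[of "integral (g ` S) F"]
    have JF_int: "(\<lambda>x. J x * F (g x)) absolutely_integrable_on S"
      and eq: "integral S (\<lambda>x. J x * F (g x)) = integral (g ` S) F" by simp_all
    have "(LINT x:S|lborel. J x * F (g x)) = integral S (\<lambda>x. J x * F (g x))"
      by (simp only: set_lebesgue_integral_eq_integral(2)[OF JF_int] flip: set_lebesgue_lborel(2)[OF S c])
    also have "\<dots> = (LINT y:g ` S|lborel. F y)"
      by (simp only: eq set_lebesgue_integral_eq_integral(2)[OF F_int] flip: set_lebesgue_lborel(2)[OF gS F])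
    finally show ?thesis .
  next
    case False
    with iff show ?thesis
      by (simp add: set_integrable_def set_lebesgue_integral_def not_integrable_integral_eq)
  qed
qed

definition pair_of_vec :: "real^2 \<Rightarrow> real \<times> real" where
  "pair_of_vec v = (v $ 1, v $ 2)"

definition complex_of_vec :: "real^2 \<Rightarrow> complex" where
  "complex_of_vec v = Complex (v $ 1) (v $ 2)"

definition vec_of_complex :: "complex \<Rightarrow> real^2" where
  "vec_of_complex z = vector [Re z, Im z]"

lemma complex_of_vec_inverse [simp]: "complex_of_vec (vec_of_complex z) = z"
  by (simp add: complex_of_vec_def vec_of_complex_def complex_eq_iff)

lemma vec_of_complex_inverse [simp]: "vec_of_complex (complex_of_vec v) = v"
  by (simp add: complex_of_vec_def vec_of_complex_def vec_eq_iff forall_2)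

lemma vec_of_complex_nth [simp]:
  "vec_of_complex z $ 1 = Re z" "vec_of_complex z $ 2 = Im z"
  by (simp_all add: vec_of_complex_def)

lemma linear_pair_of_vec: "linear pair_of_vec"
  by (rule linearI) (auto simp: pair_of_vec_def)

lemma linear_complex_of_vec: "linear complex_of_vec"
  by (rule linearI) (auto simp: complex_of_vec_def complex_eq_iff)

lemma linear_vec_of_complex: "linear vec_of_complex"
  by (rule linearI) (auto simp: vec_eq_iff forall_2)

lemma Basis_vec_2: "(Basis :: (real^2) set) = {axis 1 1, axis 2 1}"
  by (auto simp: Basis_vec_def UNIV_2)

lemma distr_pair_of_vec: "distr lborel borel pair_of_vec = lborel"
  by (rule lborel_distr_coordinate_isometry)
    (auto simp: linear_pair_of_vec pair_of_vec_def inner_vec_def UNIV_2 Basis_vec_2 Basis_prod_def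
      axis_def)

lemma distr_complex_of_vec: "distr lborel borel complex_of_vec = lborel"
  by (rule lborel_distr_coordinate_isometry)
    (auto simp: linear_complex_of_vec complex_of_vec_def inner_vec_def UNIV_2 Basis_vec_2
      Basis_complex_def axis_def inner_complex_def complex_eq_iff)

text \<open>
  The transformation formula for maps of \<open>real^2\<close>, transported along the coordinate isometries. If \<open>A\<close>
  and \<open>B\<close> are the two partial derivatives of \<open>g\<close>, regarded as complex numbers, the Jacobian
  determinant \<open>Re A * Im B - Re B * Im A\<close> is \<open>Im (cnj A * B)\<close>.
\<close>

lemma plane_change_of_variables:
  fixes F :: "complex \<Rightarrow> real" and g :: "real \<times> real \<Rightarrow> complex"
  assumes S: "open S" and gS: "open (g ` S)"
    and der: "\<And>x. x \<in> S \<Longrightarrow> (g has_derivative (\<lambda>h. fst h *\<^sub>R A x + snd h *\<^sub>R B x)) (at x)"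
    and inj: "inj_on g S"
    and J: "\<And>x. x \<in> S \<Longrightarrow> \<bar>Im (cnj (A x) * B x)\<bar> = J x" "continuous_on S J"
    and F: "continuous_on (g ` S) F"
  shows "set_integrable lborel S (\<lambda>x. J x * F (g x)) \<longleftrightarrow> set_integrable lborel (g ` S) F"
    and "(LINT x:S|lborel. J x * F (g x)) = (LINT z:g ` S|lborel. F z)"
proof -
  have blp: "bounded_linear pair_of_vec" and blc: "bounded_linear complex_of_vec"
      and blv: "bounded_linear vec_of_complex"
    using linear_pair_of_vec linear_complex_of_vec linear_vec_of_complex
    by (simp_all add: linear_conv_bounded_linear)
  have cp: "continuous_on X pair_of_vec" and cc: "continuous_on X complex_of_vec" for X
    using blp blc by (auto intro: linear_continuous_on)
  have gc: "continuous_on S g"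
    by (intro continuous_at_imp_continuous_on ballI has_derivative_continuous[OF der])
  define S' where "S' = pair_of_vec -` S"
  define g' where "g' v = vec_of_complex (g (pair_of_vec v))" for v
  define D where "D v h = vec_of_complex (h $ 1 *\<^sub>R A (pair_of_vec v) + h $ 2 *\<^sub>R B (pair_of_vec v))"
    for v and h :: "real^2"
  have surj: "pair_of_vec ` S' = S"
  proof -
    have "(a, b) \<in> pair_of_vec ` S'" if "(a, b) \<in> S" for a b
      using that by (intro image_eqI[of _ _ "vector [a, b]"]) (auto simp: S'_def pair_of_vec_def)
    thus ?thesis by (auto simp: S'_def)
  qed
  have im: "g' ` S' = complex_of_vec -` (g ` S)"
  proof (intro set_eqI iffI)
    fix v assume "v \<in> complex_of_vec -` (g ` S)"
    then obtain x where "x \<in> S" "complex_of_vec v = g x" by auto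
    with surj obtain y where "y \<in> S'" "complex_of_vec v = g (pair_of_vec y)" by auto
    hence "v = g' y" by (metis g'_def vec_of_complex_inverse)
    with \<open>y \<in> S'\<close> show "v \<in> g' ` S'" by blast
  qed (use surj in \<open>auto simp: g'_def\<close>)
  have S'o: "open S'"
    unfolding S'_def using S cp by (intro open_vimage) auto
  have gS'o: "open (g' ` S')"
    unfolding im using gS cc by (intro open_vimage) auto
  have "inj_on g' S'"
  proof (rule inj_onI)
    fix v w assume vw: "v \<in> S'" "w \<in> S'" "g' v = g' w"
    hence "g (pair_of_vec v) = g (pair_of_vec w)"
      by (metis g'_def complex_of_vec_inverse)
    hence "pair_of_vec v = pair_of_vec w" using inj vw by (auto simp: S'_def dest: inj_onD)
    thus "v = w" by (simp add: pair_of_vec_def vec_eq_iff forall_2)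
  qed
  moreover have "(g' has_derivative D v) (at v)" if "v \<in> S'" for v
  proof -
    have "(g has_derivative (\<lambda>h. fst h *\<^sub>R A (pair_of_vec v) + snd h *\<^sub>R B (pair_of_vec v)))
        (at (pair_of_vec v))"
      using that by (intro der) (simp add: S'_def)
    from has_derivative_compose[OF bounded_linear_imp_has_derivative[OF blp] this]
    have "((\<lambda>v. g (pair_of_vec v)) has_derivative
        (\<lambda>h. h $ 1 *\<^sub>R A (pair_of_vec v) + h $ 2 *\<^sub>R B (pair_of_vec v))) (at v)"
      by (simp add: pair_of_vec_def)
    from bounded_linear.has_derivative[OF blv this] show ?thesis
      by (simp add: g'_def[abs_def] D_def[abs_def])
  qed
  moreover have "\<bar>det (matrix (D v))\<bar> = J (pair_of_vec v)" if "v \<in> S'" for v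
    using J(1)[of "pair_of_vec v"] that
    by (simp add: det_2 matrix_def D_def S'_def axis_def algebra_simps)
  moreover have "continuous_on S' (\<lambda>v. J (pair_of_vec v))"
    by (rule continuous_on_compose2[OF J(2) cp]) (auto simp: S'_def)
  moreover have "continuous_on (g' ` S') (\<lambda>v. F (complex_of_vec v))"
    by (rule continuous_on_compose2[OF F cc]) (auto simp: im)
  ultimately have main:
    "set_integrable lborel S' (\<lambda>v. J (pair_of_vec v) * F (complex_of_vec (g' v)))
       \<longleftrightarrow> set_integrable lborel (g' ` S') (\<lambda>v. F (complex_of_vec v))"
    "(LINT v:S'|lborel. J (pair_of_vec v) * F (complex_of_vec (g' v)))
       = (LINT v:g' ` S'|lborel. F (complex_of_vec v))"
    using continuous_change_of_variables[OF S'o gS'o, of D "\<lambda>v. J (pair_of_vec v)"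
        "\<lambda>v. F (complex_of_vec v)"] by blast+
  have c: "continuous_on S (\<lambda>x. J x * F (g x))"
    by (intro continuous_on_mult J continuous_on_compose2[OF F gc] subset_refl)
  have mp: "pair_of_vec \<in> borel_measurable borel" and mc: "complex_of_vec \<in> borel_measurable borel"
    using cp cc by (auto intro!: borel_measurable_continuous_onI)
  show "set_integrable lborel S (\<lambda>x. J x * F (g x)) \<longleftrightarrow> set_integrable lborel (g ` S) F"
    using main(1) set_lborel_transport(1)[OF mp distr_pair_of_vec S c]
      set_lborel_transport(1)[OF mc distr_complex_of_vec gS F]
    by (simp add: g'_def S'_def im[unfolded g'_def S'_def])
  show "(LINT x:S|lborel. J x * F (g x)) = (LINT z:g ` S|lborel. F z)"
    using main(2) set_lborel_transport(2)[OF mp distr_pair_of_vec S c]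
      set_lborel_transport(2)[OF mc distr_complex_of_vec gS F]
    by (simp add: g'_def S'_def im[unfolded g'_def S'_def])
qed

section \<open>The orbit map from the group to the disc\<close>

text \<open>
  The image of the origin of the disc under the Moebius transformation with matrix
  rows \<open>(\<alpha>, \<beta>)\<close> and \<open>(cnj \<beta>, cnj \<alpha>)\<close>.
\<close>

definition disc_point :: "real \<times> real \<Rightarrow> complex" where
  "disc_point = (\<lambda>(a, b). SU_beta a b / cnj (SU_alpha a b))"

lemma SU_alpha_Re_pos: "a > 0 \<Longrightarrow> Re (SU_alpha a b) > 0"
  by (simp add: SU_alpha_def add_pos_pos)

lemma SU_alpha_nonzero: "a > 0 \<Longrightarrow> SU_alpha a b \<noteq> 0"
  using SU_alpha_Re_pos[of a b] by auto

lemma cmod_disc_point: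
  assumes "a > 0"
  shows "1 - (cmod (disc_point (a, b)))\<^sup>2 = 1 / (cmod (SU_alpha a b))\<^sup>2"
proof -
  have "(cmod (SU_alpha a b))\<^sup>2 \<noteq> 0" using SU_alpha_nonzero[OF assms] by simp
  moreover have "(cmod (disc_point (a, b)))\<^sup>2 = (cmod (SU_beta a b))\<^sup>2 / (cmod (SU_alpha a b))\<^sup>2"
    by (simp add: disc_point_def norm_divide power_divide)
  moreover have "(cmod (SU_beta a b))\<^sup>2 = (cmod (SU_alpha a b))\<^sup>2 - 1"
    using SU_alpha_beta[OF assms, of b] by simp
  ultimately show ?thesis by (simp add: diff_divide_distrib)
qed

lemma disc_point_in_disc: "a > 0 \<Longrightarrow> cmod (disc_point (a, b)) < 1"
proof -
  assume a: "a > 0"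
  have "0 < 1 / (cmod (SU_alpha a b))\<^sup>2" using SU_alpha_nonzero[OF a] by simp
  hence "(cmod (disc_point (a, b)))\<^sup>2 < 1\<^sup>2" unfolding cmod_disc_point[OF a, of b, symmetric] by simp
  thus ?thesis by (rule power_less_imp_less_base) simp
qed

text \<open>
  Because \<open>(a + 1 / a)\<^sup>2 + b\<^sup>2 = (2 * cmod \<alpha>)\<^sup>2\<close>, the weight is a power of \<open>cmod \<alpha>\<close> and therefore,
  by \<open>cmod_disc_point\<close>, a function of the modulus of the orbit point.
\<close>

lemma weight_eq:
  assumes "a > 0"
  shows "weight r (a, b) = 4 powr r * cmod (SU_alpha a b) powr r"
proof -
  have n: "cmod (SU_alpha a b) > 0" using SU_alpha_nonzero[OF assms] by simp
  have "(a + inverse a)\<^sup>2 + b\<^sup>2 = (2 * cmod (SU_alpha a b))\<^sup>2"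
    unfolding SU_alpha_def power_mult_distrib cmod_power2 by (simp add: field_simps)
  also have "\<dots> powr (r / 2) = (2 * cmod (SU_alpha a b)) powr r"
    using n powr_numeral[of "2 * cmod (SU_alpha a b)" "num.Bit0 num.One", symmetric]
    by (simp only: powr_powr) simp
  finally have "weight r (a, b) = 2 powr r * (2 powr r * cmod (SU_alpha a b) powr r)"
    using n by (simp add: weight_def powr_mult)
  also have "\<dots> = (2 * 2) powr r * cmod (SU_alpha a b) powr r"
    by (subst powr_mult) auto
  finally show ?thesis by simp
qed

section \<open>The voice transform against the constant function\<close>

lemma hs_weight_pochhammer:
  assumes "s > 0"
  shows "hs_weight s k = pochhammer s k / fact k"
  using assms by (simp add: hs_weight_def pochhammer_Gamma Gamma_real_pos nonpos_Ints_def)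

text \<open>
  The generalised binomial coefficient of \<open>- s\<close> over \<open>k\<close> is \<open>(- 1) ^ k * hs_weight s k\<close>, and the signs are
  absorbed by expanding at \<open>- x\<close>.
\<close>

lemma hs_weight_sums:
  assumes "s > 0" "cmod x < 1"
  shows "(\<lambda>k. of_real (hs_weight s k) * x ^ k) sums (1 - x) powr (- of_real s)"
proof -
  have "(- of_real s gchoose k) * (- x) ^ k = of_real (hs_weight s k) * x ^ k" for k
  proof -
    have "(- of_real s gchoose k) = (- 1) ^ k * (of_real (hs_weight s k) :: complex)"
      using assms(1) by (simp add: gbinomial_pochhammer hs_weight_pochhammer flip: pochhammer_of_real)
    thus ?thesis by (cases "even k") simp_all
  qed
  thus ?thesis
    using gen_binomial_complex[of "- x" "- of_real s"] assms(2) by simp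
qed

lemma fps_expansion_eqI_sums:
  fixes f :: "complex \<Rightarrow> complex"
  assumes R: "R > 0" and sums: "\<And>z. cmod z < R \<Longrightarrow> (\<lambda>k. fps_nth F k * z ^ k) sums f z"
  shows "fps_expansion f 0 = F"
proof (rule fps_expansion_eqI)
  have "conv_radius (fps_nth F) \<ge> norm (of_real (R / 2) :: complex)"
    using sums[of "of_real (R / 2)"] R by (intro conv_radius_geI) (auto simp: sums_iff)
  moreover have "0 < ereal (norm (of_real (R / 2) :: complex))" using R by simp
  ultimately have "fps_conv_radius F > 0"
    unfolding fps_conv_radius_def by (rule order.strict_trans2[rotated])
  moreover have "eventually (\<lambda>z. eval_fps F z = f z) (nhds 0)"
    using eventually_nhds_in_open[of "ball 0 R" "0 :: complex"] R
    by (auto elim!: eventually_mono simp: eval_fps_def sums_iff dest!: sums)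
  ultimately show "f has_fps_expansion F" by (simp add: has_fps_expansion_def)
qed

lemma fps_expansion_pi_rep_one:
  assumes s: "s > 0" and a: "a > 0"
  shows "fps_expansion (pi_rep s (a, b) (\<lambda>_. 1)) 0 =
    Abs_fps (\<lambda>k. SU_alpha a b powr (- of_real s) * of_real (hs_weight s k) * cnj (disc_point (a, b)) ^ k)"
proof (rule fps_expansion_eqI_sums[where R = 1])
  fix z :: complex assume z: "cmod z < 1"
  have "cmod (cnj (disc_point (a, b)) * z) < 1"
    using disc_point_in_disc[OF a, of b] z
      mult_strict_mono'[of "cmod (disc_point (a, b))" 1 "cmod z" 1]
    by (simp add: norm_mult)
  from sums_mult[OF hs_weight_sums[OF s this], of "SU_alpha a b powr (- of_real s)"]
  have sums: "(\<lambda>k. SU_alpha a b powr (- of_real s) * (of_real (hs_weight s k) *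
      (cnj (disc_point (a, b)) * z) ^ k)) sums
    (SU_alpha a b powr (- of_real s) * (1 - cnj (disc_point (a, b)) * z) powr (- of_real s))" .
  have eq: "pi_rep s (a, b) (\<lambda>_. 1) z =
      SU_alpha a b powr (- of_real s) * (1 - cnj (disc_point (a, b)) * z) powr (- of_real s)"
    by (simp only: pi_rep_def Let_def split pi_rep_branch[OF a z] disc_point_def complex_cnj_divide complex_cnj_cnj mult_1_right)
  show "(\<lambda>k. fps_nth (Abs_fps (\<lambda>k. SU_alpha a b powr (- of_real s) * of_real (hs_weight s k) *
      cnj (disc_point (a, b)) ^ k)) k * z ^ k) sums pi_rep s (a, b) (\<lambda>_. 1) z"
    using sums unfolding eq power_mult_distrib by (simp only: mult.assoc fps_nth_Abs_fps)
qed simp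

text \<open>
  The weights in the expansion of \<open>\<pi>\<^sub>s(a, b) 1\<close> cancel those in the pairing, which leaves the power series
  \<open>\<phi>\<close> evaluated at the orbit point.
\<close>

lemma voice_one:
  assumes s: "s > 1" and a: "a > 0" and \<phi>: "fps_conv_radius \<phi> \<ge> 1"
  shows "voice s (\<lambda>_. 1) \<phi> (a, b) =
    cnj (SU_alpha a b powr (- of_real s)) * eval_fps \<phi> (disc_point (a, b))"
proof -
  have pos: "hs_weight s k > 0" for k
    using s by (simp add: hs_weight_def Gamma_real_pos)
  have "ereal (cmod (disc_point (a, b))) < fps_conv_radius \<phi>"
    using disc_point_in_disc[OF a, of b] by (intro less_le_trans[OF _ \<phi>]) simp
  hence "(\<lambda>k. fps_nth \<phi> k * disc_point (a, b) ^ k) sums eval_fps \<phi> (disc_point (a, b))"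
    by (rule sums_eval_fps)
  from sums_mult[OF this, of "cnj (SU_alpha a b powr (- of_real s))"]
  show ?thesis
    using s a pos[THEN less_imp_neq]
    by (simp add: voice_def dual_pairing_def fps_expansion_pi_rep_one sums_iff mult_ac)
qed

section \<open>The image of Haar measure in the disc\<close>

lemma one_minus_cmod_disc_point:
  assumes "a > 0"
  shows "1 - (cmod (disc_point (a, b)))\<^sup>2 = 4 * a\<^sup>2 / ((a * b)\<^sup>2 + (a\<^sup>2 + 1)\<^sup>2)"
proof -
  have eq: "4 * a\<^sup>2 * (cmod (SU_alpha a b))\<^sup>2 = (a * b)\<^sup>2 + (a\<^sup>2 + 1)\<^sup>2"
    using assms unfolding SU_alpha_def cmod_power2
    by (simp add: field_simps power2_eq_square)
  show ?thesis
    unfolding cmod_disc_point[OF assms] eq[symmetric] using assms by simp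
qed

abbreviation half_plane :: "(real \<times> real) set" where
  "half_plane \<equiv> {0<..} \<times> UNIV"

text \<open>
  In half plane coordinates the orbit map is \<open>(a, b) \<mapsto> a * b + \<i> * a\<^sup>2\<close>, the action of the matrix with
  rows \<open>(a, b)\<close> and \<open>(0, 1 / a)\<close> on \<open>\<i>\<close>, followed by the Cayley transform and a quarter turn. In this form
  injectivity, surjectivity and the derivative can be read off.
\<close>

lemma disc_point_cayley:
  assumes "a > 0"
  shows "disc_point (a, b) =
    \<i> * (Complex (a * b) (a\<^sup>2) - \<i>) / (Complex (a * b) (a\<^sup>2) + \<i>)"
proof -
  have e: "of_real a * cnj (SU_alpha a b) * (2 * \<i>) = Complex (a * b) (a\<^sup>2) + \<i>"
    "of_real a * SU_beta a b * 2 = Complex (a * b) (a\<^sup>2) - \<i>"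
    using assms by (simp_all add: SU_alpha_def SU_beta_def complex_eq_iff field_simps power2_eq_square)
  show ?thesis
    unfolding e[symmetric] disc_point_def using SU_alpha_nonzero[OF assms, of b] assms
    by simp
qed

lemma upper_half_plane_plus_i: "y > 0 \<Longrightarrow> Complex x y + \<i> \<noteq> 0"
  by (auto simp: complex_eq_iff)

lemma disc_point_inj: "inj_on disc_point half_plane"
proof (rule inj_onI, clarify)
  fix a b c d :: real assume ac: "a > 0" "c > 0" and eq: "disc_point (a, b) = disc_point (c, d)"
  define w w' where "w = Complex (a * b) (a\<^sup>2)" and "w' = Complex (c * d) (c\<^sup>2)"
  have nz: "w + \<i> \<noteq> 0" "w' + \<i> \<noteq> 0"
    using ac by (simp_all add: w_def w'_def upper_half_plane_plus_i)
  have "(w - \<i>) / (w + \<i>) = (w' - \<i>) / (w' + \<i>)"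
    using eq ac by (simp add: disc_point_cayley w_def w'_def flip: times_divide_eq_right)
  hence "(w - \<i>) * (w' + \<i>) = (w' - \<i>) * (w + \<i>)"
    using nz by (simp add: frac_eq_eq)
  hence "2 * \<i> * w = 2 * \<i> * w'" by (simp add: algebra_simps)
  hence "w = w'" by simp
  hence "a\<^sup>2 = c\<^sup>2" "a * b = c * d" by (simp_all add: w_def w'_def)
  thus "a = c \<and> b = d" using ac by (simp add: power2_eq_iff_nonneg)
qed

lemma disc_point_image: "disc_point ` half_plane = ball 0 1"
proof (intro equalityI subsetI)
  fix z :: complex assume z: "z \<in> ball 0 1"
  have nz: "1 + \<i> * z \<noteq> 0"
  proof
    assume "1 + \<i> * z = 0"
    hence "\<i> * z = - 1" by (simp add: add_eq_0_iff)
    hence "cmod (\<i> * z) = 1" by simp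
    thus False using z by (simp add: norm_mult)
  qed
  \<comment> \<open>The inverse of the Cayley transform; \<open>a\<^sup>2\<close> and \<open>a * b\<close> are its imaginary and real part.\<close>
  define w where "w = \<i> * (1 - \<i> * z) / (1 + \<i> * z)"
  have "Im w = (1 - (cmod z)\<^sup>2) / (cmod (1 + \<i> * z))\<^sup>2"
    unfolding w_def Im_divide cmod_power2 by (simp add: power2_eq_square algebra_simps)
  moreover have "(cmod z)\<^sup>2 < 1" using z by (simp add: abs_square_less_1)
  ultimately have w: "Im w > 0" using nz by simp
  define a b where "a = sqrt (Im w)" and "b = Re w / a"
  have a: "a > 0" using w by (simp add: a_def)
  have "Complex (a * b) (a\<^sup>2) = w"
    using w a by (simp add: complex_eq_iff b_def) (simp add: a_def)
  hence "disc_point (a, b) = \<i> * (w - \<i>) / (w + \<i>)" by (simp add: disc_point_cayley a)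
  also have "w - \<i> = 2 * z / (1 + \<i> * z)"
    using nz by (simp add: w_def field_simps)
  also have "w + \<i> = 2 * \<i> / (1 + \<i> * z)"
    using nz by (simp add: w_def field_simps)
  also have "\<i> * (2 * z / (1 + \<i> * z)) / (2 * \<i> / (1 + \<i> * z)) = z"
    using nz by simp
  finally show "z \<in> disc_point ` half_plane" using a by force
qed (auto simp: disc_point_in_disc)

lemma disc_point_has_derivative:
  fixes a b :: real
  assumes "a > 0"
  defines "d \<equiv> - 2 / (Complex (a * b) (a\<^sup>2) + \<i>)\<^sup>2"
  shows "(disc_point has_derivative
    (\<lambda>h. fst h *\<^sub>R (d * Complex b (2 * a)) + snd h *\<^sub>R (d * of_real a))) (at (a, b))"
proof -
  define W :: "real \<times> real \<Rightarrow> complex"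
    where "W x = of_real (fst x * snd x) + \<i> * of_real ((fst x)\<^sup>2)" for x
  have W: "W (a, b) = Complex (a * b) (a\<^sup>2)" for a b
    by (simp add: W_def complex_eq_iff)
  have "(W has_derivative (\<lambda>h. fst h *\<^sub>R Complex b (2 * a) + snd h *\<^sub>R of_real a)) (at (a, b))"
    unfolding W_def[abs_def]
    by (rule derivative_eq_intros refl | simp)+
      (auto simp: fun_eq_iff complex_eq_iff algebra_simps)
  moreover have nz: "W (a, b) + \<i> \<noteq> 0"
    using assms by (simp add: W upper_half_plane_plus_i)
  have "((\<lambda>w. \<i> * (w - \<i>) / (w + \<i>)) has_field_derivative d) (at (W (a, b)))"
    using nz unfolding d_def W[symmetric]
    by (auto intro!: derivative_eq_intros simp: field_simps power2_eq_square)
  hence "((\<lambda>w. \<i> * (w - \<i>) / (w + \<i>)) has_derivative (*) d) (at (W (a, b)))"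
    by (simp add: has_field_derivative_def)
  ultimately have "((\<lambda>x. \<i> * (W x - \<i>) / (W x + \<i>)) has_derivative
      (\<lambda>h. d * (fst h *\<^sub>R Complex b (2 * a) + snd h *\<^sub>R of_real a))) (at (a, b))"
    by (rule has_derivative_compose)
  hence "((\<lambda>x. \<i> * (W x - \<i>) / (W x + \<i>)) has_derivative
      (\<lambda>h. fst h *\<^sub>R (d * Complex b (2 * a)) + snd h *\<^sub>R (d * of_real a))) (at (a, b))"
    by (simp add: ring_distribs)
  moreover have "open half_plane" by (intro open_Times) auto
  ultimately show ?thesis
    by (rule has_derivative_transform_within_open)
      (use assms in \<open>auto simp: disc_point_cayley W\<close>)
qed

text \<open>
  This is the invariance of hyperbolic area: \<open>1 / a\<^sup>2\<close> is the density of Haar measure, and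
  \<open>(1 - (cmod z)\<^sup>2)\<^sup>2\<close> is the reciprocal of the density of the invariant area in the disc.
\<close>

lemma disc_point_jacobian:
  fixes a b :: real
  assumes "a > 0"
  defines "d \<equiv> - 2 / (Complex (a * b) (a\<^sup>2) + \<i>)\<^sup>2"
  shows "\<bar>Im (cnj (d * Complex b (2 * a)) * (d * of_real a))\<bar> =
    (1 - (cmod (disc_point (a, b)))\<^sup>2)\<^sup>2 / (2 * a\<^sup>2)"
proof -
  have "cnj (d * Complex b (2 * a)) * (d * of_real a) =
      (d * cnj d) * (cnj (Complex b (2 * a)) * of_real a)" by (simp add: mult_ac)
  also have "d * cnj d = of_real ((cmod d)\<^sup>2)" by (simp flip: complex_norm_square)
  also have "\<bar>Im (of_real ((cmod d)\<^sup>2) * (cnj (Complex b (2 * a)) * of_real a))\<bar> =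
      (cmod d)\<^sup>2 * (2 * a\<^sup>2)"
    using assms(1) by (simp add: abs_mult power2_eq_square)
  also have "cmod d = 2 / ((a * b)\<^sup>2 + (a\<^sup>2 + 1)\<^sup>2)"
    by (simp add: d_def norm_divide norm_power cmod_power2)
  also have "(2 / D)\<^sup>2 * (2 * a\<^sup>2) = (4 * a\<^sup>2 / D)\<^sup>2 / (2 * a\<^sup>2)" for D :: real
    using assms(1) by (cases "D = 0") (simp_all add: field_simps power2_eq_square)
  finally show ?thesis
    using assms(1) by (simp add: one_minus_cmod_disc_point)
qed

lemma disc_point_continuous: "continuous_on half_plane disc_point"
  using has_derivative_continuous[OF disc_point_has_derivative]
  by (intro continuous_at_imp_continuous_on) auto

lemma haar_measurableI:
  assumes "continuous_on half_plane f"
  shows "f \<in> borel_measurable haar_G"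
proof -
  have "f \<in> borel_measurable (restrict_space borel half_plane)"
    using assms by (rule borel_measurable_continuous_on_restrict)
  moreover have "sets (restrict_space lborel half_plane) = sets (restrict_space borel half_plane)"
    by (intro sets_restrict_space_cong) simp
  ultimately show ?thesis
    unfolding haar_G_def by (simp cong: measurable_cong_sets)
qed

text \<open>
  Haar measure is the image of \<open>2 / (1 - (cmod z)\<^sup>2)\<^sup>2\<close> times area under the inverse of the orbit map;
  the formula is the change of variables \<open>z = disc_point x\<close>.
\<close>

lemma haar_disc:
  fixes F :: "complex \<Rightarrow> real"
  assumes F: "continuous_on (ball 0 1) F"
  shows "integrable haar_G (\<lambda>x. F (disc_point x)) \<longleftrightarrow>
      set_integrable lborel (ball 0 1) (\<lambda>z. F z / (1 - (cmod z)\<^sup>2)\<^sup>2)"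
    and "(LINT x|haar_G. F (disc_point x)) =
      2 * (LINT z:ball 0 1|lborel. F z / (1 - (cmod z)\<^sup>2)\<^sup>2)"
proof -
  define J where "J x = (1 - (cmod (disc_point x))\<^sup>2)\<^sup>2 / (2 * (fst x)\<^sup>2)" for x
  \<comment> \<open>\<open>G\<close> is chosen so that the Jacobian \<open>J\<close> times \<open>G\<close> at the orbit point is \<open>F\<close> there times the Haar density.\<close>
  define G where "G z = 2 * (F z / (1 - (cmod z)\<^sup>2)\<^sup>2)" for z
  have one_minus: "1 - (cmod z)\<^sup>2 > 0" if "z \<in> ball 0 1" for z :: complex
    using that by (simp add: abs_square_less_1)
  have open_H: "open half_plane" by (intro open_Times) auto
  have Fc: "continuous_on half_plane (\<lambda>x. F (disc_point x))"
    using F disc_point_continuous disc_point_image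
    by (auto intro: continuous_on_compose2)
  have Gc: "continuous_on (ball 0 1) G"
    unfolding G_def using one_minus by (intro continuous_intros F) force
  have Jc: "continuous_on half_plane J"
    unfolding J_def by (intro continuous_intros disc_point_continuous) auto
  define d where "d x = - 2 / (Complex (fst x * snd x) ((fst x)\<^sup>2) + \<i>)\<^sup>2" for x
  have der: "(disc_point has_derivative (\<lambda>h. fst h *\<^sub>R (d x * Complex (snd x) (2 * fst x)) +
      snd h *\<^sub>R (d x * of_real (fst x)))) (at x)" if "x \<in> half_plane" for x
    using disc_point_has_derivative[of "fst x" "snd x"] that by (auto simp: d_def)
  have jac: "\<bar>Im (cnj (d x * Complex (snd x) (2 * fst x)) * (d x * of_real (fst x)))\<bar> = J x"
    if "x \<in> half_plane" for x
    using disc_point_jacobian[of "fst x" "snd x"] that by (auto simp: d_def J_def)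
  have cov: "set_integrable lborel half_plane (\<lambda>x. J x * G (disc_point x)) \<longleftrightarrow>
      set_integrable lborel (ball 0 1) G"
    "(LINT x:half_plane|lborel. J x * G (disc_point x)) = (LINT z:ball 0 1|lborel. G z)"
    using plane_change_of_variables[OF open_H _ der disc_point_inj jac Jc, of G] Gc
    by (simp_all add: disc_point_image)
  have JG: "J x * G (disc_point x) = 1 / (fst x)\<^sup>2 * F (disc_point x)" if "x \<in> half_plane" for x
    using one_minus[of "disc_point x"] that disc_point_image by (force simp: J_def G_def)
  have m: "(\<lambda>x. F (disc_point x)) \<in> borel_measurable (restrict_space lborel half_plane)"
    using haar_measurableI[OF Fc] by (simp add: haar_G_def)
  have meas: "(\<lambda>x. 1 / (fst x)\<^sup>2) \<in> borel_measurable (restrict_space lborel half_plane)"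
  proof -
    have [measurable]: "(fst :: real \<times> real \<Rightarrow> real) \<in> borel_measurable borel"
      by (intro borel_measurable_continuous_onI continuous_intros)
    show ?thesis by (intro measurable_restrict_space1) simp
  qed
  have haar: "haar_G = density (restrict_space lborel half_plane) (\<lambda>x. ennreal (1 / (fst x)\<^sup>2))"
    unfolding haar_G_def case_prod_unfold ..
  have sets_H: "half_plane \<inter> space lborel \<in> sets lborel"
    using borel_open[OF open_H] by simp
  have "integrable haar_G (\<lambda>x. F (disc_point x)) \<longleftrightarrow>
      set_integrable lborel half_plane (\<lambda>x. 1 / (fst x)\<^sup>2 * F (disc_point x))"
    unfolding haar set_integrable_def real_scaleR_def[symmetric]
    by (subst integrable_density[OF m meas], (rule AE_I2, simp)) (rule integrable_restrict_space[OF sets_H])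
  also have "\<dots> \<longleftrightarrow> set_integrable lborel half_plane (\<lambda>x. J x * G (disc_point x))"
    by (intro set_integrable_cong refl) (simp only: JG)
  also have "\<dots> \<longleftrightarrow> set_integrable lborel (ball 0 1) G"
    by (rule cov(1))
  finally show "integrable haar_G (\<lambda>x. F (disc_point x)) \<longleftrightarrow>
      set_integrable lborel (ball 0 1) (\<lambda>z. F z / (1 - (cmod z)\<^sup>2)\<^sup>2)"
    by (simp add: G_def[abs_def] del: times_divide_eq_right)
  have "(LINT x|haar_G. F (disc_point x)) =
      (LINT x:half_plane|lborel. 1 / (fst x)\<^sup>2 * F (disc_point x))"
    unfolding haar set_lebesgue_integral_def real_scaleR_def[symmetric]
    by (subst integral_density[OF m meas], (rule AE_I2, simp)) (rule integral_restrict_space[OF sets_H])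
  also have "\<dots> = (LINT x:half_plane|lborel. J x * G (disc_point x))"
    by (rule set_lebesgue_integral_cong)
      (use borel_open[OF open_H] JG in \<open>simp only: sets_lborel, metis\<close>)
  also have "\<dots> = (LINT z:ball 0 1|lborel. G z)"
    by (rule cov(2))
  finally show "(LINT x|haar_G. F (disc_point x)) =
      2 * (LINT z:ball 0 1|lborel. F z / (1 - (cmod z)\<^sup>2)\<^sup>2)"
    by (simp add: G_def[abs_def] del: times_divide_eq_right)
qed

section \<open>Taylor coefficients as area integrals\<close>

text \<open>
  The change of variables \<open>(x, y) \<mapsto> c * (x + \<i> * y)\<close> has Jacobian determinant \<open>(cmod c)\<^sup>2 = 1\<close>. The left
  side is an integral over real coordinates; comparing the cases \<open>c\<close> and \<open>1\<close> turns it into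
  \<open>rotation_invariance\<close>.
\<close>

lemma rotation_plane:
  fixes F :: "complex \<Rightarrow> real"
  assumes c: "cmod c = 1" and F: "continuous_on (ball 0 R) F"
  shows "(LINT x:{x. Complex (fst x) (snd x) \<in> ball 0 R}|lborel. F (c * Complex (fst x) (snd x))) =
    (LINT z:ball 0 R|lborel. F z)"
proof -
  define S where "S = {x. Complex (fst x) (snd x) \<in> ball 0 R}"
  define g where "g x = c * Complex (fst x) (snd x)" for x
  have cc: "continuous_on UNIV (\<lambda>x :: real \<times> real. Complex (fst x) (snd x))"
    unfolding Complex_eq by (intro continuous_intros)
  have c0: "c \<noteq> 0" and cc1: "cnj c * c = 1"
    using c by auto (metis complex_norm_square mult.commute norm_one of_real_1 one_power2)
  have "open ((\<lambda>x. Complex (fst x) (snd x)) -` ball 0 R)"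
    by (intro open_vimage cc) simp
  hence S: "open S" by (simp add: S_def vimage_def)
  have im: "g ` S = ball 0 R"
  proof (intro equalityI subsetI)
    fix z :: complex assume z: "z \<in> ball 0 R"
    have "z = g (Re (z / c), Im (z / c))" using c0 by (simp add: g_def)
    moreover have "(Re (z / c), Im (z / c)) \<in> S"
      using z c by (simp add: S_def norm_divide)
    ultimately show "z \<in> g ` S" by blast
  qed (use c in \<open>auto simp: g_def S_def norm_mult\<close>)
  have der: "(g has_derivative (\<lambda>h. fst h *\<^sub>R c + snd h *\<^sub>R (c * \<i>))) (at x)" for x
    unfolding g_def[abs_def] Complex_eq
    by (rule derivative_eq_intros refl | simp)+ (auto simp: scaleR_conv_of_real algebra_simps)
  have inj: "inj_on g S" using c0 by (auto simp: inj_on_def g_def)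
  have J: "\<bar>Im (cnj c * (c * \<i>))\<bar> = 1"
    by (simp add: cc1 flip: mult.assoc)
  have "(LINT x:S|lborel. 1 * F (g x)) = (LINT z:g ` S|lborel. F z)"
    by (rule plane_change_of_variables(2)[OF S _ der inj J]) (use F im in simp_all)
  thus ?thesis unfolding im by (simp add: S_def g_def)
qed

lemma rotation_invariance:
  fixes F :: "complex \<Rightarrow> real"
  assumes c: "cmod c = 1" and F: "continuous_on (ball 0 R) F"
  shows "(LINT z:ball 0 R|lborel. F (c * z)) = (LINT z:ball 0 R|lborel. F z)"
proof -
  have "continuous_on (ball 0 R) (\<lambda>z. F (c * z))"
    by (rule continuous_on_compose2[OF F]) (use c in \<open>auto intro!: continuous_intros simp: norm_mult\<close>)
  from rotation_plane[OF norm_one this] rotation_plane[OF c F] show ?thesis by simp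
qed

lemma set_integrable_ball:
  fixes F :: "complex \<Rightarrow> 'b::{banach, second_countable_topology}"
  assumes "continuous_on (cball c R) F"
  shows "set_integrable lborel (ball c R) F"
proof (rule set_integrable_subset)
  show "set_integrable lborel (cball c R) F"
    unfolding set_integrable_def by (rule borel_integrable_compact[OF compact_cball assms])
qed (simp_all add: ball_subset_cball)

lemma set_integral_subset_le:
  fixes f :: "'a \<Rightarrow> real"
  assumes f: "set_integrable M A f" and B: "B \<in> sets M" "B \<subseteq> A" and nonneg: "\<And>x. x \<in> A \<Longrightarrow> 0 \<le> f x"
  shows "(LINT x:B|M. f x) \<le> (LINT x:A|M. f x)"
  unfolding set_lebesgue_integral_def
proof (rule integral_mono_AE)
  show "integrable M (\<lambda>x. indicator B x *\<^sub>R f x)"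
    using set_integrable_subset[OF f B] by (simp add: set_integrable_def)
  show "integrable M (\<lambda>x. indicator A x *\<^sub>R f x)"
    using f by (simp add: set_integrable_def)
qed (use B nonneg in \<open>auto simp: indicator_def\<close>)

text \<open>
  Under the rotation by the angle \<open>pi / (n - k)\<close> the integrand changes sign, while the integral over the
  disc is invariant.
\<close>

lemma integral_monomials_orthogonal:
  assumes "n \<noteq> k"
  shows "(LINT z:ball 0 R|lborel. z ^ n * cnj z ^ k) = 0"
proof -
  define F where "F z = z ^ n * cnj z ^ k" for z :: complex
  define c where "c = cis (pi / (real n - real k))"
  have "F (c * z) = - F z" for z
  proof -
    have "F (c * z) = c ^ n * cnj c ^ k * F z"
      by (simp add: F_def power_mult_distrib)
    also have "c ^ n * cnj c ^ k = cis (real n * (pi / (real n - real k)) - real k * (pi / (real n - real k)))"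
      by (simp only: c_def cis_cnj Complex.DeMoivre cis_mult mult_minus_right diff_conv_add_uminus)
    also have "real n * (pi / (real n - real k)) - real k * (pi / (real n - real k)) = pi"
      unfolding left_diff_distrib[symmetric] using assms by simp
    finally show ?thesis by simp
  qed
  note neg = this
  have Fc: "continuous_on A F" for A
    unfolding F_def[abs_def] by (intro continuous_intros)
  have zero: "(LINT z:ball 0 R|lborel. G (F z)) = 0" if "linear G" for G :: "complex \<Rightarrow> real"
  proof -
    have "continuous_on (ball 0 R) (\<lambda>z. G (F z))"
      by (rule continuous_on_compose2[OF linear_continuous_on Fc])
        (use that in \<open>auto simp: linear_conv_bounded_linear\<close>)
    moreover have "cmod c = 1" by (simp add: c_def)
    ultimately have "(LINT z:ball 0 R|lborel. G (F (c * z))) = (LINT z:ball 0 R|lborel. G (F z))"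
      by (intro rotation_invariance)
    hence "(LINT z:ball 0 R|lborel. - G (F z)) = (LINT z:ball 0 R|lborel. G (F z))"
      by (simp add: neg linear_neg[OF that])
    thus ?thesis by (simp add: set_lebesgue_integral_def)
  qed
  have int: "set_integrable lborel (ball 0 R) F"
    by (rule set_integrable_ball[OF Fc])
  have "Re (LINT z:ball 0 R|lborel. F z) = (LINT z:ball 0 R|lborel. Re (F z))"
    "Im (LINT z:ball 0 R|lborel. F z) = (LINT z:ball 0 R|lborel. Im (F z))"
    using int unfolding set_integrable_def set_lebesgue_integral_def
    by (simp_all flip: integral_Re integral_Im)
  moreover have "linear Re" "linear Im"
    by (simp_all add: bounded_linear.linear bounded_linear_Re bounded_linear_Im)
  ultimately show ?thesis
    using zero[of Re] zero[of Im] by (simp add: complex_eq_iff F_def[symmetric])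
qed

text \<open>
  Integrating the Taylor series term by term, only the \<open>k\<close>-th term survives, by orthogonality. Term by term
  integration is justified because the series converges absolutely on the circle of radius
  \<open>\<delta>\<close>, inside the unit disc.
\<close>

lemma integral_coefficient:
  fixes f :: "complex \<Rightarrow> complex"
  assumes \<delta>: "0 \<le> \<delta>" "\<delta> < 1" and f: "f holomorphic_on ball 0 1"
  shows "(LINT z:ball 0 \<delta>|lborel. f z * cnj z ^ k) =
    fps_nth (fps_expansion f 0) k * of_real (LINT z:ball 0 \<delta>|lborel. cmod z ^ (2 * k))"
proof -
  define b where "b = fps_nth (fps_expansion f 0)"
  have sums: "(\<lambda>n. b n * z ^ n) sums f z" if "cmod z < 1" for z
    using that has_fps_expansion_imp_sums_complex[of f "fps_expansion f 0" 1 z] f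
      has_fps_expansion_fps_expansion[of "ball 0 1" f]
    by (simp add: b_def one_ereal_def)
  define h where "h n z = indicator (ball 0 \<delta>) z *\<^sub>R (b n * (z ^ n * cnj z ^ k))" for n z
  have int: "integrable lborel (h n)" for n
    unfolding h_def[abs_def] set_integrable_def[symmetric]
    by (intro set_integrable_ball continuous_intros)
  have "conv_radius b \<ge> 1"
    using conv_radius_fps_expansion[of f 0 1] f
    by (simp add: b_def fps_conv_radius_def one_ereal_def)
  hence "summable (\<lambda>n. norm (b n * of_real \<delta> ^ n))"
    using \<delta> by (intro abs_summable_in_conv_radius) (simp add: less_le_trans[of _ 1])
  hence sumb: "summable (\<lambda>n. cmod (b n) * \<delta> ^ n)"
    using \<delta> by (simp add: norm_mult norm_power)
  have bound: "norm (h n z) \<le> cmod (b n) * \<delta> ^ n * indicator (ball 0 \<delta>) z" for n z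
  proof (cases "z \<in> ball 0 \<delta>")
    case True
    hence "cmod z ^ n \<le> \<delta> ^ n" "cmod z ^ k \<le> 1"
      using \<delta> by (auto intro!: power_mono power_le_one)
    hence "cmod z ^ n * cmod z ^ k \<le> \<delta> ^ n * 1" by (intro mult_mono) (use \<delta> in auto)
    thus ?thesis using True by (simp add: h_def norm_mult norm_power mult_left_mono)
  qed (simp add: h_def)
  have AE: "AE z in lborel. summable (\<lambda>n. norm (h n z))"
  proof (rule AE_I2)
    fix z :: complex
    show "summable (\<lambda>n. norm (h n z))"
      by (rule summable_comparison_test'[OF summable_mult2[OF sumb, of "indicator (ball 0 \<delta>) z"], of 0])
        (use bound in auto)
  qed
  have norm_int: "(LINT z|lborel. norm (h n z)) \<le> cmod (b n) * \<delta> ^ n * measure lborel (ball 0 \<delta> :: complex set)" for n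
  proof -
    have "(LINT z|lborel. norm (h n z)) \<le>
        (LINT z|lborel. cmod (b n) * \<delta> ^ n * indicator (ball (0 :: complex) \<delta>) z)"
    proof (rule integral_mono_AE)
      show "integrable lborel (\<lambda>z. norm (h n z))" using int by (rule integrable_norm)
      show "integrable lborel (\<lambda>z. cmod (b n) * \<delta> ^ n * indicator (ball (0 :: complex) \<delta>) z :: real)"
        using emeasure_bounded_finite[of "ball 0 \<delta> :: complex set"]
        by (intro integrable_mult_right integrable_real_indicator) auto
    qed (use bound in auto)
    thus ?thesis by simp
  qed
  have "summable (\<lambda>n. LINT z|lborel. norm (h n z))"
    by (rule summable_comparison_test'[OF summable_mult2[OF sumb], of 0])
      (use norm_int in \<open>auto simp: abs_of_nonneg\<close>)
  from sums_integral[OF int AE this]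
  have S: "(\<lambda>n. LINT z|lborel. h n z) sums (LINT z|lborel. (\<Sum>n. h n z))" .
  have "(\<Sum>n. h n z) = indicator (ball 0 \<delta>) z *\<^sub>R (f z * cnj z ^ k)" for z
  proof (cases "z \<in> ball 0 \<delta>")
    case True
    hence "(\<lambda>n. b n * z ^ n * cnj z ^ k) sums (f z * cnj z ^ k)"
      using \<delta> by (intro sums_mult2 sums) simp
    thus ?thesis using True by (simp add: h_def sums_iff mult.assoc)
  qed (simp add: h_def)
  with S have S: "(\<lambda>n. LINT z|lborel. h n z) sums (LINT z:ball 0 \<delta>|lborel. f z * cnj z ^ k)"
    by (simp add: set_lebesgue_integral_def)
  have h: "(LINT z|lborel. h n z) = b n * (LINT z:ball 0 \<delta>|lborel. z ^ n * cnj z ^ k)" for n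
    by (simp add: h_def set_lebesgue_integral_def[symmetric])
  have "(LINT z:ball 0 \<delta>|lborel. z ^ k * cnj z ^ k) =
      (LINT z:ball 0 \<delta>|lborel. complex_of_real (cmod z ^ (2 * k)))"
    by (simp only: power_mult of_real_power[of "(cmod _)\<^sup>2"] complex_norm_square power_mult_distrib)
  also have "\<dots> = of_real (LINT z:ball 0 \<delta>|lborel. cmod z ^ (2 * k))"
    by (rule set_integral_complex_of_real)
  finally have "(LINT z|lborel. h k z) = b k * of_real (LINT z:ball 0 \<delta>|lborel. cmod z ^ (2 * k))"
    by (simp add: h)
  moreover have "(LINT z|lborel. h n z) = 0" if "n \<noteq> k" for n
    using that by (simp add: h integral_monomials_orthogonal)
  hence "(\<lambda>n. LINT z|lborel. h n z) sums (LINT z|lborel. h k z)"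
    using sums_finite[of "{k}" "\<lambda>n. LINT z|lborel. h n z"] by simp
  ultimately show ?thesis using sums_unique2[OF S] by (simp add: b_def)
qed

text \<open>
  At distance of order \<open>1 / k\<close> from the unit circle, \<open>cmod z ^ (2 * k)\<close> is bounded below. The integral is
  therefore at least a constant times the area of a disc of radius of order \<open>1 / k\<close> that fits into the
  thin annulus \<open>1 - \<epsilon> \<le> cmod z < 1 - \<epsilon> / 4\<close>.
\<close>

lemma integral_cmod_power_lower_bound:
  fixes k :: nat
  defines "\<epsilon> \<equiv> 1 / (4 * (1 + real k))"
  shows "measure lborel (ball 0 1 :: complex set) * (\<epsilon> / 4)\<^sup>2 / 2 \<le>
    (LINT z:ball 0 (1 - \<epsilon> / 4)|lborel. cmod z ^ (2 * k))"
proof -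
  have \<epsilon>: "\<epsilon> > 0" "\<epsilon> \<le> 1 / 4" by (simp_all add: \<epsilon>_def field_simps)
  \<comment> \<open>\<open>B\<close> is centred in the middle of the annulus, with a radius that keeps it at distance \<open>\<epsilon> / 4\<close> from the inner circle and inside the outer one.\<close>
  define B where "B = ball (of_real (1 - \<epsilon> / 2) :: complex) (\<epsilon> / 4)"
  have zB: "1 - \<epsilon> \<le> cmod z \<and> cmod z < 1 - \<epsilon> / 4" if "z \<in> B" for z
  proof -
    have "cmod (of_real (1 - \<epsilon> / 2)) = 1 - \<epsilon> / 2" using \<epsilon> by (simp only: norm_of_real)
    moreover have "\<bar>cmod (of_real (1 - \<epsilon> / 2)) - cmod z\<bar> < \<epsilon> / 4"
      using that norm_triangle_ineq3[of "of_real (1 - \<epsilon> / 2)" z] by (simp add: B_def dist_norm)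
    ultimately show ?thesis using \<epsilon> by (simp only: abs_less_iff) linarith
  qed
  have "1 / 2 \<le> 1 + real (2 * k) * (- \<epsilon>)" by (simp add: \<epsilon>_def field_simps)
  also have "\<dots> \<le> (1 + (- \<epsilon>)) ^ (2 * k)" using \<epsilon> by (intro Bernoulli_inequality) simp
  finally have half: "1 / 2 \<le> (1 - \<epsilon>) ^ (2 * k)" by simp
  have "measure lborel (ball 0 1 :: complex set) * (\<epsilon> / 4)\<^sup>2 / 2 = (LINT z:B|lborel. 1 / 2)"
    using content_ball_conv_unit_ball[of "\<epsilon> / 4" "of_real (1 - \<epsilon> / 2) :: complex"] \<epsilon>
    by (simp add: B_def set_lebesgue_integral_def mult.commute)
  also have "\<dots> \<le> (LINT z:B|lborel. cmod z ^ (2 * k))"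
  proof (rule set_integral_mono)
    fix z assume "z \<in> B"
    hence "(1 - \<epsilon>) ^ (2 * k) \<le> cmod z ^ (2 * k)"
      using zB \<epsilon> by (intro power_mono) auto
    with half show "1 / 2 \<le> cmod z ^ (2 * k)" by simp
  next
    show "set_integrable lborel B (\<lambda>z. 1 / 2 :: real)" "set_integrable lborel B (\<lambda>z. cmod z ^ (2 * k))"
      unfolding B_def by (intro set_integrable_ball continuous_intros)+
  qed
  also have "\<dots> \<le> (LINT z:ball 0 (1 - \<epsilon> / 4)|lborel. cmod z ^ (2 * k))"
  proof (rule set_integral_subset_le)
    show "set_integrable lborel (ball 0 (1 - \<epsilon> / 4)) (\<lambda>z :: complex. cmod z ^ (2 * k))"
      by (intro set_integrable_ball continuous_intros)
  qed (use zB in \<open>auto simp: B_def\<close>)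
  finally show ?thesis .
qed

section \<open>Growth of coefficients of distribution vectors\<close>

lemma hs_weight_ge_1:
  assumes "s \<ge> 1"
  shows "hs_weight s k \<ge> 1"
proof -
  have "fact k = pochhammer 1 k" by (simp add: pochhammer_fact)
  also have "pochhammer 1 k \<le> pochhammer s k"
    unfolding pochhammer_prod using assms by (intro prod_mono) auto
  finally show ?thesis using assms by (simp add: hs_weight_pochhammer)
qed

text \<open>
  Consecutive weights have the ratio \<open>1 + (s - 1) / (1 + k)\<close>, which Bernoulli's inequality bounds by the
  ratio \<open>(1 + 1 / (1 + k)) ^ N\<close> of consecutive values of \<open>(1 + k) ^ N\<close>.
\<close>

lemma hs_weight_le:
  assumes "s > 0" "s - 1 \<le> real N"
  shows "hs_weight s k \<le> (1 + real k) ^ N"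
proof (induction k)
  case (Suc k)
  have "hs_weight s (Suc k) = hs_weight s k * ((s + real k) / (1 + real k))"
    using assms by (simp add: hs_weight_pochhammer pochhammer_Suc field_simps)
  also have "\<dots> \<le> (1 + real k) ^ N * ((2 + real k) / (1 + real k)) ^ N"
  proof (rule mult_mono[OF Suc.IH])
    have "(s + real k) / (1 + real k) = 1 + (s - 1) * (1 / (1 + real k))"
      by (simp add: field_simps)
    also have "\<dots> \<le> 1 + real N * (1 / (1 + real k))"
      using assms by (intro add_left_mono mult_right_mono) auto
    also have "\<dots> \<le> (1 + 1 / (1 + real k)) ^ N" by (rule Bernoulli_inequality) (simp add: order_trans[of _ 0])
    also have "1 + 1 / (1 + real k) = (2 + real k) / (1 + real k)" by (simp add: field_simps)
    finally show "(s + real k) / (1 + real k) \<le> ((2 + real k) / (1 + real k)) ^ N" .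
  qed (use assms in auto)
  also have "\<dots> = (1 + real (Suc k)) ^ N"
    by (simp add: add_ac flip: power_mult_distrib)
  finally show ?case .
qed (use assms in \<open>simp add: hs_weight_def Gamma_real_pos less_imp_neq[symmetric]\<close>)

lemma summable_poly_geometric:
  assumes "0 \<le> r" "r < 1"
  shows "summable (\<lambda>k. (1 + real k) ^ M * r ^ k)"
proof -
  have "(\<lambda>k. (1 + real k) / (2 + real k)) \<longlonglongrightarrow> 1"
    using LIMSEQ_Suc[OF LIMSEQ_n_over_Suc_n[where ?'a = real]] by (simp add: add_ac)
  hence "(\<lambda>k. ((1 + real k) / (2 + real k)) ^ M) \<longlonglongrightarrow> 1 ^ M"
    by (rule tendsto_power)
  hence "conv_radius (\<lambda>k. (1 + real k) ^ M) = 1"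
    by (intro conv_radius_ratio_limit_nonzero[where c = 1])
      (auto simp: power_divide add_ac one_ereal_def)
  thus ?thesis
    using assms by (intro summable_in_conv_radius) (simp add: one_ereal_def)
qed

lemma dist_vectors_conv_radius:
  assumes s: "s > 1" and \<phi>: "\<phi> \<in> dist_vectors s"
  shows "fps_conv_radius \<phi> \<ge> 1"
proof -
  obtain m C where C: "\<And>k. (cmod (fps_nth \<phi> k))\<^sup>2 \<le> C * hs_weight s k * (1 + real k) ^ m"
    using \<phi> by (auto simp: dist_vectors_def)
  define N where "N = nat \<lceil>s\<rceil>"
  have N: "s - 1 \<le> real N" unfolding N_def using s by linarith
  have "0 \<le> C * hs_weight s 0" using C[of 0] by (simp add: order_trans[OF zero_le_power2])
  hence C0: "C \<ge> 0" using hs_weight_ge_1[of s 0] s by (simp add: zero_le_mult_iff)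
  have bound: "cmod (fps_nth \<phi> k) \<le> (1 + C) * (1 + real k) ^ (N + m)" for k
  proof -
    have "cmod (fps_nth \<phi> k) \<le> 1 + (cmod (fps_nth \<phi> k))\<^sup>2"
      using sum_squares_bound[of "cmod (fps_nth \<phi> k)" 1] norm_ge_zero[of "fps_nth \<phi> k"]
      unfolding one_power2 by linarith
    also have "\<dots> \<le> 1 + C * (1 + real k) ^ N * (1 + real k) ^ m"
      using C0 s N by (intro add_left_mono order_trans[OF C] mult_right_mono mult_left_mono hs_weight_le) auto
    also have "\<dots> \<le> (1 + real k) ^ (N + m) + C * (1 + real k) ^ (N + m)"
      by (intro add_mono one_le_power) (auto simp: power_add)
    finally show ?thesis by (simp add: algebra_simps)
  qed
  have "conv_radius (fps_nth \<phi>) \<ge> 1"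
  proof (rule conv_radius_geI_ex')
    fix r :: real assume r: "0 < r" "ereal r < 1"
    show "summable (\<lambda>k. fps_nth \<phi> k * of_real r ^ k)"
    proof (rule summable_comparison_test'[where N = 0])
      show "summable (\<lambda>k. (1 + C) * ((1 + real k) ^ (N + m) * r ^ k))"
        using r by (intro summable_mult summable_poly_geometric) (auto simp: one_ereal_def)
      show "norm (fps_nth \<phi> k * of_real r ^ k) \<le> (1 + C) * ((1 + real k) ^ (N + m) * r ^ k)" for k
        using r bound[of k] mult_right_mono[OF bound[of k], of "r ^ k"]
        by (simp add: norm_mult norm_power mult_ac)
    qed
  qed
  thus ?thesis by (simp add: fps_conv_radius_def)
qed

section \<open>Growth of coefficients of Bergman functions\<close>

text \<open>
  The exponent \<open>\<sigma> - 2\<close> of the Bergman weight may have either sign; a power with exponent at least its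
  absolute value bounds the weight from below in both cases.
\<close>

lemma bergman_weight_lower_bound:
  assumes "0 < \<epsilon>" "\<epsilon> \<le> t" "t \<le> (1::real)" "\<bar>e\<bar> \<le> real L"
  shows "\<epsilon> ^ L \<le> t powr e"
proof -
  have "\<epsilon> ^ L = \<epsilon> powr real L" using assms by (simp add: powr_realpow)
  also have "\<dots> \<le> t powr real L" using assms by (intro powr_mono2) auto
  also have "\<dots> \<le> t powr e" using assms by (intro powr_mono') auto
  finally show ?thesis .
qed

text \<open>
  On the disc of radius \<open>\<delta> = 1 - 1 / (16 * (1 + k))\<close> the Bergman weight is at least a fixed negative power
  of \<open>1 + k\<close>, and \<open>cmod f \<le> 1 + cmod f powr p\<close>. So the integral of \<open>cmod f\<close> over this disc grows at most
  polynomially in \<open>k\<close>. By \<open>integral_coefficient\<close> the integral is at least the \<open>k\<close>-th coefficient times a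
  number that is bounded below by a multiple of \<open>1 / (1 + k)\<^sup>2\<close>.
\<close>

lemma bergman_coefficient_bound:
  assumes p: "p \<ge> 1" and f: "f \<in> bergman_space p \<sigma>"
  shows "\<exists>M C. \<forall>k. cmod (fps_nth (fps_expansion f 0) k) \<le> C * (1 + real k) ^ M"
proof -
  have holo: "f holomorphic_on ball 0 1" and
    int: "set_integrable lborel (ball 0 1) (\<lambda>z. cmod (f z) powr p * (1 - (cmod z)\<^sup>2) powr (\<sigma> - 2))"
    using f by (auto simp: bergman_space_def)
  define I where "I = (LINT z:ball 0 1|lborel. cmod (f z) powr p * (1 - (cmod z)\<^sup>2) powr (\<sigma> - 2))"
  define V where "V = measure lborel (ball 0 1 :: complex set)"
  have V: "V > 0" using content_ball_pos[of 1 "0 :: complex"] by (simp add: V_def)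
  define L where "L = nat \<lceil>\<bar>\<sigma> - 2\<bar>\<rceil>"
  have L: "\<bar>\<sigma> - 2\<bar> \<le> real L" unfolding L_def by linarith
  have I0: "I \<ge> 0" unfolding I_def set_lebesgue_integral_def by (intro integral_nonneg_AE) simp
  have "cmod (fps_nth (fps_expansion f 0) k) \<le> (512 * (V + 16 ^ L * I) / V) * (1 + real k) ^ (L + 2)" for k
  proof -
    define \<epsilon> where "\<epsilon> = 1 / (4 * (1 + real k))"
    define \<delta> where "\<delta> = 1 - \<epsilon> / 4"
    have \<epsilon>: "\<epsilon> > 0" "\<epsilon> \<le> 1 / 4" by (simp_all add: \<epsilon>_def field_simps)
    have \<delta>: "0 \<le> \<delta>" "\<delta> < 1" using \<epsilon> by (simp_all add: \<delta>_def)
    have sub: "ball 0 \<delta> \<subseteq> ball (0::complex) 1" "cball 0 \<delta> \<subseteq> ball (0::complex) 1" using \<delta> by auto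
    have fc: "continuous_on (cball 0 \<delta>) f"
      using holomorphic_on_imp_continuous_on[OF holo] sub continuous_on_subset by blast
    have eps4: "\<epsilon> / 4 = 1 / (16 * (1 + real k))" by (simp add: \<epsilon>_def)
    have E: "(\<epsilon> / 4) ^ L > 0" using \<epsilon> by simp
    define g where "g z = cmod (f z) powr p * (1 - (cmod z)\<^sup>2) powr (\<sigma> - 2)" for z
    have gint: "set_integrable lborel (ball 0 \<delta>) g"
      using sub by (intro set_integrable_subset[OF int[folded g_def]]) auto
    have pw: "cmod (f z) \<le> 1 + g z / (\<epsilon> / 4) ^ L" if "z \<in> ball 0 \<delta>" for z
    proof -
      have "(cmod z)\<^sup>2 \<le> cmod z * 1"
        unfolding power2_eq_square using that \<delta> by (intro mult_left_mono) auto
      hence "(\<epsilon> / 4) ^ L \<le> (1 - (cmod z)\<^sup>2) powr (\<sigma> - 2)"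
        using that \<epsilon> L by (intro bergman_weight_lower_bound) (auto simp: \<delta>_def)
      hence "cmod (f z) powr p * (\<epsilon> / 4) ^ L \<le> g z"
        unfolding g_def by (intro mult_left_mono) auto
      hence "cmod (f z) powr p \<le> g z / (\<epsilon> / 4) ^ L" using E by (simp only: pos_le_divide_eq)
      moreover have "cmod (f z) \<le> 1 + cmod (f z) powr p"
      proof (cases "cmod (f z) \<le> 1")
        case False
        hence "cmod (f z) powr 1 \<le> cmod (f z) powr p" using p by (intro powr_mono) auto
        thus ?thesis using False by simp
      qed (simp add: add_increasing2)
      ultimately show ?thesis by linarith
    qed
    have g_le: "(LINT z:ball 0 \<delta>|lborel. g z) \<le> I"
      unfolding I_def g_def[symmetric] using sub
      by (intro set_integral_subset_le int[folded g_def]) (auto simp: g_def)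
    have one_le: "(LINT z:ball (0::complex) \<delta>|lborel. 1 :: real) \<le> V"
    proof -
      have "measure lborel (ball (0::complex) \<delta>) \<le> V"
        unfolding V_def using sub emeasure_bounded_finite[of "ball (0::complex) 1"]
        by (intro measure_mono_fmeasurable) (auto simp: fmeasurable_def)
      thus ?thesis by (simp add: set_lebesgue_integral_def)
    qed
    have "cmod (LINT z:ball 0 \<delta>|lborel. f z * cnj z ^ k) \<le>
        (LINT z:ball 0 \<delta>|lborel. norm (f z * cnj z ^ k))"
      by (intro set_integral_norm_bound set_integrable_ball continuous_intros fc)
    also have "\<dots> \<le> (LINT z:ball 0 \<delta>|lborel. 1 + g z / (\<epsilon> / 4) ^ L)"
    proof (rule set_integral_mono)
      fix z :: complex assume z: "z \<in> ball 0 \<delta>"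
      have "norm (f z * cnj z ^ k) \<le> cmod (f z) * 1"
        unfolding norm_mult norm_power using z \<delta> by (intro mult_left_mono power_le_one) auto
      thus "norm (f z * cnj z ^ k) \<le> 1 + g z / (\<epsilon> / 4) ^ L" using pw[OF z] by linarith
    next
      show "set_integrable lborel (ball 0 \<delta>) (\<lambda>z. norm (f z * cnj z ^ k))"
        by (intro set_integrable_ball continuous_intros fc)
      show "set_integrable lborel (ball 0 \<delta>) (\<lambda>z. 1 + g z / (\<epsilon> / 4) ^ L)"
        by (intro set_integral_add set_integrable_divide gint set_integrable_ball continuous_intros)
    qed
    also have "\<dots> = (LINT z:ball (0::complex) \<delta>|lborel. 1 :: real) + (LINT z:ball 0 \<delta>|lborel. g z / (\<epsilon> / 4) ^ L)"
      by (intro set_integral_add set_integrable_divide gint set_integrable_ball continuous_intros)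
    also have "\<dots> \<le> V + I / (\<epsilon> / 4) ^ L"
    proof (rule add_mono[OF one_le])
      show "(LINT z:ball 0 \<delta>|lborel. g z / (\<epsilon> / 4) ^ L) \<le> I / (\<epsilon> / 4) ^ L"
        using divide_right_mono[OF g_le less_imp_le[OF E]] by simp
    qed
    finally have upper: "cmod (LINT z:ball 0 \<delta>|lborel. f z * cnj z ^ k) \<le> V + I / (\<epsilon> / 4) ^ L" .
    have lower: "V * (\<epsilon> / 4)\<^sup>2 / 2 \<le> (LINT z:ball 0 \<delta>|lborel. cmod (z::complex) ^ (2 * k))"
      using integral_cmod_power_lower_bound[of k] by (simp add: V_def \<delta>_def \<epsilon>_def)
    have "cmod (fps_nth (fps_expansion f 0) k) * (V * (\<epsilon> / 4)\<^sup>2 / 2) \<le>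
      cmod (fps_nth (fps_expansion f 0) k) * \<bar>LINT z:ball 0 \<delta>|lborel. cmod (z::complex) ^ (2 * k)\<bar>"
      using lower by (intro mult_left_mono) auto
    also have "\<dots> \<le> V + I / (\<epsilon> / 4) ^ L"
      using upper unfolding integral_coefficient[OF \<delta> holo] norm_mult norm_of_real .
    also have "V + I / (\<epsilon> / 4) ^ L = V + 16 ^ L * I * (1 + real k) ^ L"
      unfolding eps4 power_one_over power_mult_distrib by simp
    also have "\<dots> \<le> V * (1 + real k) ^ L + 16 ^ L * I * (1 + real k) ^ L"
      using V by (intro add_right_mono) simp
    also have "\<dots> = (V + 16 ^ L * I) * (1 + real k) ^ L" by (simp add: ring_distribs)
    also have "V * (\<epsilon> / 4)\<^sup>2 / 2 = V / (512 * (1 + real k)\<^sup>2)"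
      unfolding eps4 power_one_over power_mult_distrib by simp
    finally have "cmod (fps_nth (fps_expansion f 0) k) \<le>
        (V + 16 ^ L * I) * (1 + real k) ^ L * (512 * (1 + real k)\<^sup>2) / V"
      using V by (simp add: pos_le_divide_eq pos_divide_le_eq del: distrib_left_numeral)
    moreover have "x * y * (512 * t) / V = 512 * x / V * (y * t)" for x y t :: real by simp
    ultimately show ?thesis unfolding power_add by simp
  qed
  thus ?thesis by blast
qed

lemma bergman_expansion_dist_vectors:
  assumes s: "s > 1" and p: "p \<ge> 1" and f: "f \<in> bergman_space p \<sigma>"
  shows "fps_expansion f 0 \<in> dist_vectors s"
proof -
  obtain M C where C: "\<And>k. cmod (fps_nth (fps_expansion f 0) k) \<le> C * (1 + real k) ^ M"
    using bergman_coefficient_bound[OF p f] by blast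
  have "(cmod (fps_nth (fps_expansion f 0) k))\<^sup>2 \<le> C\<^sup>2 * hs_weight s k * (1 + real k) ^ (2 * M)" for k
  proof -
    have "(cmod (fps_nth (fps_expansion f 0) k))\<^sup>2 \<le> (C * (1 + real k) ^ M)\<^sup>2"
      by (intro power_mono C) simp
    also have "\<dots> = C\<^sup>2 * 1 * (1 + real k) ^ (2 * M)"
      by (simp add: power_mult_distrib power_mult mult.commute)
    also have "\<dots> \<le> C\<^sup>2 * hs_weight s k * (1 + real k) ^ (2 * M)"
      using hs_weight_ge_1[of s k] s by (intro mult_right_mono mult_left_mono) auto
    finally show ?thesis .
  qed
  thus ?thesis by (auto simp: dist_vectors_def)
qed

section \<open>Comparison of the two spaces\<close>

lemma holomorphic_disc_expansion:
  assumes "f holomorphic_on ball 0 1"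
  shows "fps_conv_radius (fps_expansion f 0) \<ge> 1"
    and "cmod z < 1 \<Longrightarrow> eval_fps (fps_expansion f 0) z = f z"
  using conv_radius_fps_expansion[of f 0 1] eval_fps_expansion'[of f 0 1 z] assms
  by (simp_all add: one_ereal_def)

lemma space_haar_G: "space haar_G = half_plane"
  by (simp add: haar_G_def space_restrict_space)

text \<open>
  The factors \<open>cmod \<alpha> powr (- s)\<close> from the representation and \<open>cmod \<alpha> powr r\<close> from the weight combine to
  \<open>cmod \<alpha> powr (r - s)\<close>, whose \<open>p\<close>-th power is a power of \<open>1 - (cmod \<omega>)\<^sup>2\<close> because \<open>cmod \<alpha>\<close> is the
  inverse square root of the latter.
\<close>

lemma voice_weighted:
  assumes s: "s > 1" and p: "p \<ge> 1" and f: "f holomorphic_on ball 0 1" and x: "x \<in> half_plane"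
  shows "cmod (voice s (\<lambda>_. 1) (fps_expansion f 0) x * of_real (weight r x)) powr p =
    4 powr (r * p) * (cmod (f (disc_point x)) powr p *
      (1 - (cmod (disc_point x))\<^sup>2) powr ((s - r) * p / 2))"
proof -
  obtain a b where ab: "x = (a, b)" "a > 0" using x by auto
  define A where "A = cmod (SU_alpha a b)"
  have A: "A > 0" using SU_alpha_nonzero[OF ab(2)] by (simp add: A_def)
  have "cmod (voice s (\<lambda>_. 1) (fps_expansion f 0) x * of_real (weight r x)) =
      A powr (- s) * cmod (f (disc_point x)) * (4 powr r * A powr r)"
    using s ab disc_point_in_disc[OF ab(2), of b] holomorphic_disc_expansion[OF f]
    by (simp add: voice_one norm_mult norm_powr_real_powr' weight_eq A_def)
  also have "\<dots> = 4 powr r * (cmod (f (disc_point x)) * A powr (r - s))"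
    by (simp add: powr_diff powr_minus field_simps)
  also have "\<dots> powr p = 4 powr (r * p) * (cmod (f (disc_point x)) powr p * A powr ((r - s) * p))"
    by (simp add: powr_mult powr_powr)
  also have "A powr ((r - s) * p) = (1 - (cmod (disc_point x))\<^sup>2) powr ((s - r) * p / 2)"
  proof -
    have "1 - (cmod (disc_point x))\<^sup>2 = A powr (- 2)"
      using cmod_disc_point[OF ab(2), of b] A
      by (simp add: ab A_def powr_minus inverse_eq_divide)
    thus ?thesis by (simp add: powr_powr) (simp add: field_simps)
  qed
  finally show ?thesis .
qed

lemma voice_continuous:
  assumes s: "s > 1" and f: "f holomorphic_on ball 0 1"
  shows "continuous_on half_plane (voice s (\<lambda>_. 1) (fps_expansion f 0))"
proof -
  have c: "continuous_on half_plane (\<lambda>x. SU_alpha (fst x) (snd x))"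
    unfolding SU_alpha_def by (intro continuous_intros) auto
  have "continuous_on half_plane (\<lambda>x. f (disc_point x))"
    by (rule continuous_on_compose2[OF holomorphic_on_imp_continuous_on[OF f] disc_point_continuous])
      (simp add: disc_point_image)
  hence "continuous_on half_plane
      (\<lambda>x. cnj (SU_alpha (fst x) (snd x) powr (- of_real s)) * f (disc_point x))"
    by (intro continuous_intros c) (auto simp: SU_alpha_nonzero simp: SU_alpha_Re_pos less_imp_le)
  thus ?thesis
    by (rule continuous_on_eq)
      (use s holomorphic_disc_expansion[OF f] disc_point_in_disc in \<open>auto simp: voice_one\<close>)
qed

text \<open>
  The exponent \<open>(s - r) * p / 2\<close> of \<open>voice_weighted\<close> is lowered by 2 by the density of the invariant measure,
  which gives the exponent in the Bergman norm. The constants are \<open>4 powr r\<close> from the weight and the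
  factor 2 between Haar measure and invariant area.
\<close>

lemma bergman_Lpr:
  assumes s: "s > 1" and p: "p \<ge> 1" and f: "f holomorphic_on ball 0 1"
  shows "voice s (\<lambda>_. 1) (fps_expansion f 0) \<in> Lpr_space p r \<longleftrightarrow> f \<in> bergman_space p ((s - r) * p / 2)"
    and "Lpr_norm p r (voice s (\<lambda>_. 1) (fps_expansion f 0)) =
      4 powr r * 2 powr (1 / p) * bergman_norm p ((s - r) * p / 2) f"
proof -
  define \<sigma> where "\<sigma> = (s - r) * p / 2"
  define g where "g z = cmod (f z) powr p * (1 - (cmod z)\<^sup>2) powr (\<sigma> - 2)" for z
  define F where "F z = 4 powr (r * p) * (cmod (f z) powr p * (1 - (cmod z)\<^sup>2) powr \<sigma>)" for z
  have one_minus: "1 - (cmod z)\<^sup>2 > 0" if "cmod z < 1" for z :: complex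
    using that by (simp add: abs_square_less_1)
  have Fc: "continuous_on (ball 0 1) F"
    unfolding F_def using p one_minus
    by (intro continuous_intros continuous_on_powr' holomorphic_on_imp_continuous_on[OF f]) force+
  have Fg: "F z / (1 - (cmod z)\<^sup>2)\<^sup>2 = 4 powr (r * p) * g z" if "z \<in> ball 0 1" for z
    using one_minus[of z] that by (simp add: F_def g_def powr_diff)
  have voice: "cmod (voice s (\<lambda>_. 1) (fps_expansion f 0) x * of_real (weight r x)) powr p = F (disc_point x)"
    if "x \<in> space haar_G" for x
    using voice_weighted[OF s p f, of x r] that by (simp add: space_haar_G F_def \<sigma>_def)
  have "integrable haar_G (\<lambda>x. cmod (voice s (\<lambda>_. 1) (fps_expansion f 0) x * of_real (weight r x)) powr p)
      \<longleftrightarrow> integrable haar_G (\<lambda>x. F (disc_point x))"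
    by (intro Bochner_Integration.integrable_cong refl voice)
  also have "\<dots> \<longleftrightarrow> set_integrable lborel (ball 0 1) (\<lambda>z. F z / (1 - (cmod z)\<^sup>2)\<^sup>2)"
    by (rule haar_disc(1)[OF Fc])
  also have "\<dots> \<longleftrightarrow> set_integrable lborel (ball 0 1) (\<lambda>z. 4 powr (r * p) * g z)"
    by (intro set_integrable_cong refl Fg)
  also have "\<dots> \<longleftrightarrow> set_integrable lborel (ball 0 1) g" by simp
  finally show "voice s (\<lambda>_. 1) (fps_expansion f 0) \<in> Lpr_space p r \<longleftrightarrow>
      f \<in> bergman_space p ((s - r) * p / 2)"
    using haar_measurableI[OF voice_continuous[OF s f]] f
    by (simp add: Lpr_space_def bergman_space_def g_def[abs_def] \<sigma>_def)
  have "(LINT x|haar_G. cmod (voice s (\<lambda>_. 1) (fps_expansion f 0) x * of_real (weight r x)) powr p)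
      = (LINT x|haar_G. F (disc_point x))"
    by (intro Bochner_Integration.integral_cong refl voice)
  also have "\<dots> = 2 * (LINT z:ball 0 1|lborel. F z / (1 - (cmod z)\<^sup>2)\<^sup>2)"
    by (rule haar_disc(2)[OF Fc])
  also have "(LINT z:ball 0 1|lborel. F z / (1 - (cmod z)\<^sup>2)\<^sup>2) =
      (LINT z:ball 0 1|lborel. 4 powr (r * p) * g z)"
    by (intro set_lebesgue_integral_cong) (auto simp: Fg)
  also have "\<dots> = 4 powr (r * p) * (LINT z:ball 0 1|lborel. g z)" by simp
  finally have "Lpr_norm p r (voice s (\<lambda>_. 1) (fps_expansion f 0)) =
      (2 * (4 powr (r * p) * (LINT z:ball 0 1|lborel. g z))) powr (1 / p)"
    by (simp add: Lpr_norm_def)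
  also have "(LINT z:ball 0 1|lborel. g z) \<ge> 0"
    unfolding set_lebesgue_integral_def by (intro integral_nonneg_AE) (simp add: g_def)
  hence "(2 * (4 powr (r * p) * (LINT z:ball 0 1|lborel. g z))) powr (1 / p) =
      4 powr r * 2 powr (1 / p) * (LINT z:ball 0 1|lborel. g z) powr (1 / p)"
    using p by (simp add: powr_mult powr_powr)
  finally show "Lpr_norm p r (voice s (\<lambda>_. 1) (fps_expansion f 0)) =
      4 powr r * 2 powr (1 / p) * bergman_norm p ((s - r) * p / 2) f"
    by (simp add: bergman_norm_def g_def \<sigma>_def)
qed

theorem theorem4p5:
  fixes s r p :: real
  assumes "s > 1" and "r \<ge> 0" and "1 \<le> p"
    and "1 < (s - r) * p / 2" and "(s - r) * p / 2 < (s - 1) * p + 1"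
  shows "(\<lambda>f. fps_expansion f 0) ` bergman_space p ((s - r) * p / 2) = coorbit s (\<lambda>_. 1) p r \<and>
    (\<exists>c C. 0 < c \<and> 0 < C \<and>
      (\<forall>f \<in> bergman_space p ((s - r) * p / 2).
         c * bergman_norm p ((s - r) * p / 2) f \<le> coorbit_norm s (\<lambda>_. 1) p r (fps_expansion f 0) \<and>
         coorbit_norm s (\<lambda>_. 1) p r (fps_expansion f 0) \<le> C * bergman_norm p ((s - r) * p / 2) f))"
proof (intro conjI exI ballI)
  note s = assms(1) and p = assms(3)
  define \<sigma> where "\<sigma> = (s - r) * p / 2"
  have holo: "f holomorphic_on ball 0 1" if "f \<in> bergman_space p \<sigma>" for f
    using that by (simp add: bergman_space_def)
  show "(\<lambda>f. fps_expansion f 0) ` bergman_space p ((s - r) * p / 2) = coorbit s (\<lambda>_. 1) p r"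
    unfolding \<sigma>_def[symmetric]
  proof (intro equalityI subsetI)
    fix \<phi> assume "\<phi> \<in> (\<lambda>f. fps_expansion f 0) ` bergman_space p \<sigma>"
    then obtain f where f: "f \<in> bergman_space p \<sigma>" "\<phi> = fps_expansion f 0" by auto
    thus "\<phi> \<in> coorbit s (\<lambda>_. 1) p r"
      using bergman_expansion_dist_vectors[OF s p f(1)] bergman_Lpr(1)[OF s p holo[OF f(1)], of r]
      by (simp add: coorbit_def \<sigma>_def)
  next
    fix \<phi> assume "\<phi> \<in> coorbit s (\<lambda>_. 1) p r"
    hence \<phi>: "\<phi> \<in> dist_vectors s" "voice s (\<lambda>_. 1) \<phi> \<in> Lpr_space p r"
      by (auto simp: coorbit_def)
    have R: "fps_conv_radius \<phi> \<ge> 1" by (rule dist_vectors_conv_radius[OF s \<phi>(1)])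
    have h: "eval_fps \<phi> holomorphic_on ball 0 1"
    proof (rule holomorphic_on_eval_fps, rule subsetI)
      fix z :: complex assume "z \<in> ball 0 1"
      hence "ereal (cmod z) < 1" by (simp add: one_ereal_def)
      also note R
      finally show "z \<in> eball 0 (fps_conv_radius \<phi>)" by simp
    qed
    have "0 < fps_conv_radius \<phi>"
      using less_le_trans[OF _ R, of 0] by simp
    hence "fps_expansion (eval_fps \<phi>) 0 = \<phi>"
      by (intro fps_expansion_eqI eval_fps_has_fps_expansion)
    thus "\<phi> \<in> (\<lambda>f. fps_expansion f 0) ` bergman_space p \<sigma>"
      using \<phi>(2) bergman_Lpr(1)[OF s p h, of r] by (intro image_eqI[of _ _ "eval_fps \<phi>"]) (auto simp: \<sigma>_def)
  qed
  show "0 < 4 powr r * 2 powr (1 / p)" "0 < 4 powr r * 2 powr (1 / p)" by simp_all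
  fix f assume "f \<in> bergman_space p ((s - r) * p / 2)"
  hence eq: "coorbit_norm s (\<lambda>_. 1) p r (fps_expansion f 0) =
      4 powr r * 2 powr (1 / p) * bergman_norm p ((s - r) * p / 2) f"
    using bergman_Lpr(2)[OF s p holo, of f r] by (simp add: coorbit_norm_def \<sigma>_def)
  show "4 powr r * 2 powr (1 / p) * bergman_norm p ((s - r) * p / 2) f \<le>
      coorbit_norm s (\<lambda>_. 1) p r (fps_expansion f 0)"
    "coorbit_norm s (\<lambda>_. 1) p r (fps_expansion f 0) \<le>
      4 powr r * 2 powr (1 / p) * bergman_norm p ((s - r) * p / 2) f"
    unfolding eq by simp_all
qed

end
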